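(* Let $\mathcal{A}$ be a category, let $\mathcal{H} \colon \mathcal{A} \to \mathsf{CAT}$ be a pseudofunctor, and let $V \colon \int^{\mathcal{A}} \mathcal{H} \to \mathcal{A}$ be its op-Grothendieck construction. If the category $\mathcal{H}_a$ has a strict initial object $\mathsf{0}_a$ for every object $a$ of $\mathcal{A}$, and for every morphism $f \colon a \to b$ of $\mathcal{A}$ the functor $\mathcal{H}_f \colon \mathcal{H}_a \to \mathcal{H}_b$ creates initial objects, then $V$ preserves effective descent morphisms.
   Context: $\mathsf{CAT}$ is the 2-category of (possibly large) categories. The op-Grothendieck construction of a pseudofunctor $\mathcal{H} \colon \mathcal{A} \to \mathsf{CAT}$ is the projection (opfibration) $\int^{\mathcal{A}} \mathcal{H} \to \mathcal{A}$, $(a,x)\mapsto a$, where $\int^{\mathcal{A}} \mathcal{H}$ has as objects the pairs $(a,x)$ with $a$ an object of $\mathcal{A}$ and $x$ an object of $\mathcal{H}_a$, and as morphisms $(a,x)\to(b,y)$ the pairs $(f,\phi)$ with $f \colon a \to b$ in $\mathcal{A}$ and $\phi \colon \mathcal{H}_f(x) \to y$ in $\mathcal{H}_b$, with the usual composition. An initial object $\mathsf{0}$ of a category is strict if every object $x$ admitting a morphism $x \to \mathsf{0}$ is isomorphic to $\mathsf{0}$. Given that both fibers have initial objects, $\mathcal{H}_f$ creates initial objects means that it preserves and reflects them: an object $v$ of $\mathcal{H}_a$ is initial if and only if $\mathcal{H}_f(v)$ is initial in $\mathcal{H}_b$. A morphism $p \colon a \to b$ in a category $\mathcal{X}$ is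 an effective descent morphism if all pullbacks along $p$ exist in $\mathcal{X}$ (equivalently, the functor $p_! \colon \mathcal{X} \downarrow a \to \mathcal{X} \downarrow b$, $f \mapsto p \circ f$, between slice categories has a right adjoint $p^*$) and $p^*$ is monadic (its comparison functor into the Eilenberg-Moore category of the monad induced by $p_! \dashv p^*$ is an equivalence). No existence of other pullbacks in $\mathcal{X}$ is assumed. A functor $F$ preserves effective descent morphisms if $F(p)$ is an effective descent morphism whenever $p$ is. *)

theory Defs
  imports Main
begin

section \<open>Categories, functors, natural transformations\<close>

text \<open>
  Only values on \<open>Obj C\<close> and \<open>Arr C\<close> matter; the fields are unconstrained elsewhere.
  Composition is written in the order of application of functions: \<open>g \<cdot> f\<close> is ``first f, then g''.
\<close>

record ('o, 'm) cat =
  Obj :: "'o set"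
  Arr :: "'m set"
  Dom :: "'m \<Rightarrow> 'o"
  Cod :: "'m \<Rightarrow> 'o"
  Id :: "'o \<Rightarrow> 'm"
  Comp :: "'m \<Rightarrow> 'm \<Rightarrow> 'm"  (infixl "\<cdot>\<index>" 70)

definition hom :: "('o, 'm) cat \<Rightarrow> 'o \<Rightarrow> 'o \<Rightarrow> 'm set" where
  "hom C a b = {f \<in> Arr C. Dom C f = a \<and> Cod C f = b}"

locale category =
  fixes C :: "('o, 'm) cat" (structure)
  assumes dom_obj: "f \<in> Arr C \<Longrightarrow> Dom C f \<in> Obj C"
    and cod_obj: "f \<in> Arr C \<Longrightarrow> Cod C f \<in> Obj C"
    and id_hom: "a \<in> Obj C \<Longrightarrow> Id C a \<in> hom C a a"
    and comp_hom: "\<lbrakk>f \<in> hom C a b; g \<in> hom C b c\<rbrakk> \<Longrightarrow> g \<cdot> f \<in> hom C a c"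
    and comp_assoc: "\<lbrakk>f \<in> hom C a b; g \<in> hom C b c; h \<in> hom C c d\<rbrakk>
      \<Longrightarrow> (h \<cdot> g) \<cdot> f = h \<cdot> (g \<cdot> f)"
    and comp_id_left: "f \<in> hom C a b \<Longrightarrow> Id C b \<cdot> f = f"
    and comp_id_right: "f \<in> hom C a b \<Longrightarrow> f \<cdot> Id C a = f"

definition iso :: "('o, 'm) cat \<Rightarrow> 'm \<Rightarrow> bool" where
  "iso C f \<longleftrightarrow> f \<in> Arr C \<and>
    (\<exists>g \<in> hom C (Cod C f) (Dom C f).
       g \<cdot>\<^bsub>C\<^esub> f = Id C (Dom C f) \<and> f \<cdot>\<^bsub>C\<^esub> g = Id C (Cod C f))"

definition isomorphic :: "('o, 'm) cat \<Rightarrow> 'o \<Rightarrow> 'o \<Rightarrow> bool" where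
  "isomorphic C x y \<longleftrightarrow> (\<exists>f \<in> hom C x y. iso C f)"

definition initial :: "('o, 'm) cat \<Rightarrow> 'o \<Rightarrow> bool" where
  "initial C z \<longleftrightarrow> z \<in> Obj C \<and> (\<forall>x \<in> Obj C. \<exists>!f. f \<in> hom C z x)"

definition strict_initial :: "('o, 'm) cat \<Rightarrow> 'o \<Rightarrow> bool" where
  "strict_initial C z \<longleftrightarrow> initial C z \<and>
    (\<forall>x \<in> Obj C. (\<exists>f. f \<in> hom C x z) \<longrightarrow> isomorphic C x z)"

record ('o, 'm, 'p, 'n) func =
  Omap :: "'o \<Rightarrow> 'p"
  Amap :: "'m \<Rightarrow> 'n"

definition is_functor :: "('o, 'm) cat \<Rightarrow> ('p, 'n) cat \<Rightarrow> ('o, 'm, 'p, 'n) func \<Rightarrow> bool" where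
  "is_functor C D F \<longleftrightarrow> category C \<and> category D \<and>
    (\<forall>a \<in> Obj C. Omap F a \<in> Obj D) \<and>
    (\<forall>f \<in> Arr C. Amap F f \<in> hom D (Omap F (Dom C f)) (Omap F (Cod C f))) \<and>
    (\<forall>a \<in> Obj C. Amap F (Id C a) = Id D (Omap F a)) \<and>
    (\<forall>f \<in> Arr C. \<forall>g \<in> Arr C. Cod C f = Dom C g \<longrightarrow>
       Amap F (g \<cdot>\<^bsub>C\<^esub> f) = Amap F g \<cdot>\<^bsub>D\<^esub> Amap F f)"

definition id_func :: "('o, 'm, 'o, 'm) func" where
  "id_func = \<lparr>Omap = (\<lambda>a. a), Amap = (\<lambda>f. f)\<rparr>"

definition comp_func ::
  "('p, 'n, 'q, 'k) func \<Rightarrow> ('o, 'm, 'p, 'n) func \<Rightarrow> ('o, 'm, 'q, 'k) func" (infixl "\<circ>\<^sub>F" 70) where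
  "G \<circ>\<^sub>F F = \<lparr>Omap = (\<lambda>a. Omap G (Omap F a)), Amap = (\<lambda>f. Amap G (Amap F f))\<rparr>"

definition nat_trans ::
  "('o, 'm) cat \<Rightarrow> ('p, 'n) cat \<Rightarrow> ('o, 'm, 'p, 'n) func \<Rightarrow> ('o, 'm, 'p, 'n) func
    \<Rightarrow> ('o \<Rightarrow> 'n) \<Rightarrow> bool" where
  "nat_trans C D F G \<tau> \<longleftrightarrow> is_functor C D F \<and> is_functor C D G \<and>
    (\<forall>a \<in> Obj C. \<tau> a \<in> hom D (Omap F a) (Omap G a)) \<and>
    (\<forall>f \<in> Arr C. \<tau> (Cod C f) \<cdot>\<^bsub>D\<^esub> Amap F f = Amap G f \<cdot>\<^bsub>D\<^esub> \<tau> (Dom C f))"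

definition nat_iso ::
  "('o, 'm) cat \<Rightarrow> ('p, 'n) cat \<Rightarrow> ('o, 'm, 'p, 'n) func \<Rightarrow> ('o, 'm, 'p, 'n) func
    \<Rightarrow> ('o \<Rightarrow> 'n) \<Rightarrow> bool" where
  "nat_iso C D F G \<tau> \<longleftrightarrow> nat_trans C D F G \<tau> \<and> (\<forall>a \<in> Obj C. iso D (\<tau> a))"

definition is_equivalence :: "('o, 'm) cat \<Rightarrow> ('p, 'n) cat \<Rightarrow> ('o, 'm, 'p, 'n) func \<Rightarrow> bool" where
  "is_equivalence C D F \<longleftrightarrow> is_functor C D F \<and>
    (\<exists>G \<eta> \<epsilon>. is_functor D C G \<and>
       nat_iso C C id_func (G \<circ>\<^sub>F F) \<eta> \<and> nat_iso D D (F \<circ>\<^sub>F G) id_func \<epsilon>)"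

definition creates_initial_objects ::
  "('o, 'm) cat \<Rightarrow> ('p, 'n) cat \<Rightarrow> ('o, 'm, 'p, 'n) func \<Rightarrow> bool" where
  "creates_initial_objects C D F \<longleftrightarrow> (\<forall>v \<in> Obj C. initial C v \<longleftrightarrow> initial D (Omap F v))"


section \<open>Adjunctions and monadicity\<close>

definition adjunction ::
  "('o, 'm) cat \<Rightarrow> ('p, 'n) cat \<Rightarrow> ('o, 'm, 'p, 'n) func \<Rightarrow> ('p, 'n, 'o, 'm) func
    \<Rightarrow> ('o \<Rightarrow> 'm) \<Rightarrow> ('p \<Rightarrow> 'n) \<Rightarrow> bool" where
  "adjunction C D F G \<eta> \<epsilon> \<longleftrightarrow> is_functor C D F \<and> is_functor D C G \<and>
    nat_trans C C id_func (G \<circ>\<^sub>F F) \<eta> \<and> nat_trans D D (F \<circ>\<^sub>F G) id_func \<epsilon> \<and>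
    (\<forall>x \<in> Obj C. \<epsilon> (Omap F x) \<cdot>\<^bsub>D\<^esub> Amap F (\<eta> x) = Id D (Omap F x)) \<and>
    (\<forall>y \<in> Obj D. Amap G (\<epsilon> y) \<cdot>\<^bsub>C\<^esub> \<eta> (Omap G y) = Id C (Omap G y))"

definition em_algebras ::
  "('o, 'm) cat \<Rightarrow> ('o, 'm, 'o, 'm) func \<Rightarrow> ('o \<Rightarrow> 'm) \<Rightarrow> ('o \<Rightarrow> 'm) \<Rightarrow> ('o \<times> 'm) set" where
  "em_algebras C T \<eta> \<mu> = {(x, \<alpha>). x \<in> Obj C \<and> \<alpha> \<in> hom C (Omap T x) x \<and>
     \<alpha> \<cdot>\<^bsub>C\<^esub> \<eta> x = Id C x \<and> \<alpha> \<cdot>\<^bsub>C\<^esub> \<mu> x = \<alpha> \<cdot>\<^bsub>C\<^esub> Amap T \<alpha>}"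

text \<open>
  The Eilenberg-Moore category of the monad \<open>(T, \<eta>, \<mu>)\<close>. An arrow of the base category may underlie
  several algebra morphisms, so a morphism is a triple (source, underlying arrow, target);
  slice categories and the op-Grothendieck construction below are encoded in the same way.
\<close>

definition em_category ::
  "('o, 'm) cat \<Rightarrow> ('o, 'm, 'o, 'm) func \<Rightarrow> ('o \<Rightarrow> 'm) \<Rightarrow> ('o \<Rightarrow> 'm)
    \<Rightarrow> ('o \<times> 'm, ('o \<times> 'm) \<times> 'm \<times> ('o \<times> 'm)) cat" where
  "em_category C T \<eta> \<mu> =
    \<lparr>Obj = em_algebras C T \<eta> \<mu>,
     Arr = {((x, \<alpha>), f, (y, \<beta>)) | x \<alpha> f y \<beta>.
       (x, \<alpha>) \<in> em_algebras C T \<eta> \<mu> \<and> (y, \<beta>) \<in> em_algebras C T \<eta> \<mu> \<and>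
       f \<in> hom C x y \<and> f \<cdot>\<^bsub>C\<^esub> \<alpha> = \<beta> \<cdot>\<^bsub>C\<^esub> Amap T f},
     Dom = (\<lambda>(X, f, Y). X),
     Cod = (\<lambda>(X, f, Y). Y),
     Id = (\<lambda>X. (X, Id C (fst X), X)),
     Comp = (\<lambda>(Y', g, Z) (X, f, Y). (X, g \<cdot>\<^bsub>C\<^esub> f, Z))\<rparr>"

text \<open>
  \<open>G\<close> is the right adjoint of \<open>F\<close>; the induced monad is \<open>G F\<close> with unit \<open>\<eta>\<close> and
  multiplication \<open>G \<epsilon> F\<close>.
\<close>

definition induced_em_category ::
  "('o, 'm) cat \<Rightarrow> ('o, 'm, 'p, 'n) func \<Rightarrow> ('p, 'n, 'o, 'm) func
    \<Rightarrow> ('o \<Rightarrow> 'm) \<Rightarrow> ('p \<Rightarrow> 'n) \<Rightarrow> ('o \<times> 'm, ('o \<times> 'm) \<times> 'm \<times> ('o \<times> 'm)) cat" where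
  "induced_em_category C F G \<eta> \<epsilon> = em_category C (G \<circ>\<^sub>F F) \<eta> (\<lambda>x. Amap G (\<epsilon> (Omap F x)))"

definition comparison_functor ::
  "('p, 'n) cat \<Rightarrow> ('p, 'n, 'o, 'm) func \<Rightarrow> ('p \<Rightarrow> 'n)
    \<Rightarrow> ('p, 'n, 'o \<times> 'm, ('o \<times> 'm) \<times> 'm \<times> ('o \<times> 'm)) func" where
  "comparison_functor D G \<epsilon> =
    \<lparr>Omap = (\<lambda>y. (Omap G y, Amap G (\<epsilon> y))),
     Amap = (\<lambda>h. ((Omap G (Dom D h), Amap G (\<epsilon> (Dom D h))), Amap G h,
                   (Omap G (Cod D h), Amap G (\<epsilon> (Cod D h)))))\<rparr>"

definition monadic_adjunction ::
  "('o, 'm) cat \<Rightarrow> ('p, 'n) cat \<Rightarrow> ('o, 'm, 'p, 'n) func \<Rightarrow> ('p, 'n, 'o, 'm) func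
    \<Rightarrow> ('o \<Rightarrow> 'm) \<Rightarrow> ('p \<Rightarrow> 'n) \<Rightarrow> bool" where
  "monadic_adjunction C D F G \<eta> \<epsilon> \<longleftrightarrow> adjunction C D F G \<eta> \<epsilon> \<and>
    is_equivalence D (induced_em_category C F G \<eta> \<epsilon>) (comparison_functor D G \<epsilon>)"


section \<open>Slices, pullbacks and effective descent morphisms\<close>

definition slice :: "('o, 'm) cat \<Rightarrow> 'o \<Rightarrow> ('m, 'm \<times> 'm \<times> 'm) cat" where
  "slice C b =
    \<lparr>Obj = {f \<in> Arr C. Cod C f = b},
     Arr = {(f, h, g) | f h g. f \<in> Arr C \<and> Cod C f = b \<and> g \<in> Arr C \<and> Cod C g = b \<and>
       h \<in> hom C (Dom C f) (Dom C g) \<and> g \<cdot>\<^bsub>C\<^esub> h = f},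
     Dom = (\<lambda>(f, h, g). f),
     Cod = (\<lambda>(f, h, g). g),
     Id = (\<lambda>f. (f, Id C (Dom C f), f)),
     Comp = (\<lambda>(g', k, l) (f, h, g). (f, k \<cdot>\<^bsub>C\<^esub> h, l))\<rparr>"

text \<open>The functor \<open>p\<^sub>!\<close> from the slice over \<open>Dom C p\<close> to the slice over \<open>Cod C p\<close>.\<close>

definition slice_postcomp ::
  "('o, 'm) cat \<Rightarrow> 'm \<Rightarrow> ('m, 'm \<times> 'm \<times> 'm, 'm, 'm \<times> 'm \<times> 'm) func" where
  "slice_postcomp C p =
    \<lparr>Omap = (\<lambda>f. p \<cdot>\<^bsub>C\<^esub> f),
     Amap = (\<lambda>(f, h, g). (p \<cdot>\<^bsub>C\<^esub> f, h, p \<cdot>\<^bsub>C\<^esub> g))\<rparr>"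

text \<open>\<open>q\<close> and \<open>r\<close> are the projections to the domains of \<open>p\<close> and \<open>g\<close>, respectively.\<close>

definition is_pullback :: "('o, 'm) cat \<Rightarrow> 'm \<Rightarrow> 'm \<Rightarrow> 'm \<Rightarrow> 'm \<Rightarrow> bool" where
  "is_pullback C p g q r \<longleftrightarrow>
    p \<in> Arr C \<and> g \<in> Arr C \<and> Cod C p = Cod C g \<and>
    q \<in> hom C (Dom C q) (Dom C p) \<and> r \<in> hom C (Dom C q) (Dom C g) \<and>
    p \<cdot>\<^bsub>C\<^esub> q = g \<cdot>\<^bsub>C\<^esub> r \<and>
    (\<forall>s u v. u \<in> hom C s (Dom C p) \<and> v \<in> hom C s (Dom C g) \<and> p \<cdot>\<^bsub>C\<^esub> u = g \<cdot>\<^bsub>C\<^esub> v \<longrightarrow>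
       (\<exists>!h. h \<in> hom C s (Dom C q) \<and> q \<cdot>\<^bsub>C\<^esub> h = u \<and> r \<cdot>\<^bsub>C\<^esub> h = v))"

definition has_pullbacks_along :: "('o, 'm) cat \<Rightarrow> 'm \<Rightarrow> bool" where
  "has_pullbacks_along C p \<longleftrightarrow>
    (\<forall>g \<in> Arr C. Cod C g = Cod C p \<longrightarrow> (\<exists>q r. is_pullback C p g q r))"

text \<open>
  The right adjoint \<open>p\<^sup>*\<close> is unique up to a unique compatible isomorphism, and monadicity is
  invariant under it, so quantifying existentially over the adjunction loses nothing.
\<close>

definition effective_descent :: "('o, 'm) cat \<Rightarrow> 'm \<Rightarrow> bool" where
  "effective_descent C p \<longleftrightarrow> p \<in> Arr C \<and> has_pullbacks_along C p \<and>
    (\<exists>G \<eta> \<epsilon>. monadic_adjunction (slice C (Dom C p)) (slice C (Cod C p))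
       (slice_postcomp C p) G \<eta> \<epsilon>)"

definition preserves_effective_descent ::
  "('o, 'm) cat \<Rightarrow> ('p, 'n) cat \<Rightarrow> ('o, 'm, 'p, 'n) func \<Rightarrow> bool" where
  "preserves_effective_descent C D F \<longleftrightarrow>
    (\<forall>p. effective_descent C p \<longrightarrow> effective_descent D (Amap F p))"


section \<open>Pseudofunctors into categories and the op-Grothendieck construction\<close>

text \<open>
  All fibers share the same object and arrow types, but each has its own carriers; the types are
  arbitrary, so no size restriction is imposed. The coherence isomorphisms are oriented as
  \<open>\<delta> g f : H (g \<cdot> f) \<Rightarrow> H g \<circ> H f\<close> and \<open>\<iota> a : H (Id a) \<Rightarrow> Id\<close>, the direction in which composition
  and identities of the op-Grothendieck construction use them.
\<close>

record ('a, 'f, 'x, 'm) psfunctor =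
  Fib :: "'a \<Rightarrow> ('x, 'm) cat"
  Push :: "'f \<Rightarrow> ('x, 'm, 'x, 'm) func"
  Delta :: "'f \<Rightarrow> 'f \<Rightarrow> 'x \<Rightarrow> 'm"
  Iota :: "'a \<Rightarrow> 'x \<Rightarrow> 'm"

locale pseudofunctor = category A
  for A :: "('a, 'f) cat" (structure) and H :: "('a, 'f, 'x, 'm) psfunctor" +
  assumes fib_category: "a \<in> Obj A \<Longrightarrow> category (Fib H a)"
    and push_functor: "f \<in> hom A a b \<Longrightarrow> is_functor (Fib H a) (Fib H b) (Push H f)"
    and delta_iso: "\<lbrakk>f \<in> hom A a b; g \<in> hom A b c\<rbrakk> \<Longrightarrow>
      nat_iso (Fib H a) (Fib H c) (Push H (g \<cdot> f)) (Push H g \<circ>\<^sub>F Push H f) (Delta H g f)"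
    and iota_iso: "a \<in> Obj A \<Longrightarrow>
      nat_iso (Fib H a) (Fib H a) (Push H (Id A a)) id_func (Iota H a)"
    and delta_assoc:
      "\<lbrakk>f \<in> hom A a b; g \<in> hom A b c; h \<in> hom A c d; x \<in> Obj (Fib H a)\<rbrakk> \<Longrightarrow>
        Amap (Push H h) (Delta H g f x) \<cdot>\<^bsub>Fib H d\<^esub> Delta H h (g \<cdot> f) x
          = Delta H h g (Omap (Push H f) x) \<cdot>\<^bsub>Fib H d\<^esub> Delta H (h \<cdot> g) f x"
    and delta_iota_right: "\<lbrakk>f \<in> hom A a b; x \<in> Obj (Fib H a)\<rbrakk> \<Longrightarrow>
        Amap (Push H f) (Iota H a x) \<cdot>\<^bsub>Fib H b\<^esub> Delta H f (Id A a) x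
          = Id (Fib H b) (Omap (Push H f) x)"
    and delta_iota_left: "\<lbrakk>f \<in> hom A a b; x \<in> Obj (Fib H a)\<rbrakk> \<Longrightarrow>
        Iota H b (Omap (Push H f) x) \<cdot>\<^bsub>Fib H b\<^esub> Delta H (Id A b) f x
          = Id (Fib H b) (Omap (Push H f) x)"

definition opgroth ::
  "('a, 'f) cat \<Rightarrow> ('a, 'f, 'x, 'm) psfunctor
    \<Rightarrow> ('a \<times> 'x, ('a \<times> 'x) \<times> ('f \<times> 'm) \<times> ('a \<times> 'x)) cat" where
  "opgroth A H =
    \<lparr>Obj = {(a, x). a \<in> Obj A \<and> x \<in> Obj (Fib H a)},
     Arr = {((a, x), (f, \<phi>), (b, y)) | a x f \<phi> b y.
       f \<in> hom A a b \<and> x \<in> Obj (Fib H a) \<and> y \<in> Obj (Fib H b) \<and>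
       \<phi> \<in> hom (Fib H b) (Omap (Push H f) x) y},
     Dom = (\<lambda>(X, f, Y). X),
     Cod = (\<lambda>(X, f, Y). Y),
     Id = (\<lambda>(a, x). ((a, x), (Id A a, Iota H a x), (a, x))),
     Comp = (\<lambda>((b', y'), (g, \<psi>), (c, z)) ((a, x), (f, \<phi>), (b, y)).
       ((a, x),
        (g \<cdot>\<^bsub>A\<^esub> f, (\<psi> \<cdot>\<^bsub>Fib H c\<^esub> Amap (Push H g) \<phi>) \<cdot>\<^bsub>Fib H c\<^esub> Delta H g f x),
        (c, z)))\<rparr>"

definition opgroth_proj ::
  "('a \<times> 'x, ('a \<times> 'x) \<times> ('f \<times> 'm) \<times> ('a \<times> 'x), 'a, 'f) func" where
  "opgroth_proj = \<lparr>Omap = (\<lambda>(a, x). a), Amap = (\<lambda>(X, (f, \<phi>), Y). f)\<rparr>"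

end

theory Submission
  imports Defs
begin

text \<open>
  Write \<open>E\<close> for the op-Grothendieck construction of \<open>H\<close>. Since every \<open>H f\<close> preserves initial
  objects, an arrow \<open>(c, 0) \<rightarrow> (b, y)\<close> of \<open>E\<close>, with \<open>0\<close> initial in the fiber over \<open>c\<close>, is the same
  as an arrow \<open>c \<rightarrow> b\<close> of \<open>A\<close>. So \<open>J c = (c, 0)\<close> is left adjoint to the projection \<open>V\<close>, the unit is
  an identity, and up to isomorphism \<open>A\<close> is a full coreflective subcategory of \<open>E\<close>. The second
  consequence of the hypotheses is that this subcategory absorbs arrows from the left: an arrow
  \<open>(d, w) \<rightarrow> (c, 0)\<close> over \<open>r\<close> contains an arrow from \<open>H r w\<close> to \<open>0\<close>, so \<open>H r w\<close> is initial by
  strictness, and then \<open>w\<close> is initial because \<open>H r\<close> reflects initial objects.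

  Everything else uses only these two facts. They pass to slices: over an object \<open>e\<close> of \<open>E\<close>, the
  slice of \<open>A\<close> over \<open>V e\<close> is again a coreflective subcategory of the slice of \<open>E\<close> over \<open>e\<close>, and for
  \<open>p : a \<rightarrow> b\<close> in \<open>E\<close> postcomposition with \<open>p\<close> restricts to postcomposition with \<open>V p\<close>. This gives
  the situation of \<open>restricted_monadic\<close>: a monadic adjunction \<open>F \<stileturn> G\<close> between \<open>C\<close> and \<open>D\<close>,
  coreflective subcategories \<open>C\<^sub>0\<close> and \<open>D\<^sub>0\<close>, and a functor \<open>F\<^sub>0\<close> to which \<open>F\<close> restricts, compatibly
  with the coreflections \<open>V\<close> and \<open>W\<close>. Then \<open>F\<^sub>0\<close> has a right adjoint \<open>G\<^sub>0\<close>, namely \<open>G\<close> restricted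
  to \<open>D\<^sub>0\<close> and coreflected into \<open>C\<^sub>0\<close>.
  By absorption the counit \<open>F (G d) \<rightarrow> d\<close> forces \<open>G d\<close> to lie in \<open>C\<^sub>0\<close> for every \<open>d\<close> in \<open>D\<^sub>0\<close>, so the
  monad itself restricts to \<open>C\<^sub>0\<close>, and its algebras are those algebras of the big monad whose carrier
  lies in \<open>C\<^sub>0\<close>. Hence the comparison functor of \<open>F\<^sub>0 \<stileturn> G\<^sub>0\<close> is fully faithful because that of
  \<open>F \<stileturn> G\<close> is.

  For essential surjectivity, an algebra carried by an object of \<open>C\<^sub>0\<close> comes from some \<open>y\<close> in \<open>D\<close>
  with \<open>G y\<close> in \<open>C\<^sub>0\<close>, and one must see that \<open>y\<close> is in \<open>D\<^sub>0\<close>, that is, that the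
  counit \<open>\<kappa> y\<close> of the coreflection is invertible. As a monadic functor \<open>G\<close> reflects isomorphisms, so
  it suffices to invert \<open>G (\<kappa> y)\<close>. Its source and its target lie in \<open>C\<^sub>0\<close>, where \<open>V\<close> is fully
  faithful, and \<open>V (G (\<kappa> y))\<close> is invertible for every \<open>y\<close>: it is the comparison
  between the two right adjoints \<open>V G\<close> and \<open>G\<^sub>0 W\<close> of the functor \<open>F J = I F\<^sub>0\<close>, where
  \<open>I\<close> is the inclusion of \<open>D\<^sub>0\<close>.

  Pullbacks along \<open>V p\<close> are the values of the right adjoint that has been constructed.
\<close>

section \<open>Isomorphisms, functors and natural transformations\<close>

lemma homI: "f \<in> Arr C \<Longrightarrow> Dom C f = a \<Longrightarrow> Cod C f = b \<Longrightarrow> f \<in> hom C a b"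
  by (simp add: hom_def)

lemma hom_dom: "f \<in> hom C a b \<Longrightarrow> Dom C f = a"
  and hom_cod: "f \<in> hom C a b \<Longrightarrow> Cod C f = b"
  and hom_arr: "f \<in> hom C a b \<Longrightarrow> f \<in> Arr C"
  by (simp_all add: hom_def)

context category
begin

lemma hom_obj1: "f \<in> hom C a b \<Longrightarrow> a \<in> Obj C"
  and hom_obj2: "f \<in> hom C a b \<Longrightarrow> b \<in> Obj C"
  using dom_obj cod_obj by (auto simp: hom_def)

lemma isoI:
  assumes "f \<in> hom C a b" "g \<in> hom C b a" "g \<cdot> f = Id C a" "f \<cdot> g = Id C b"
  shows "iso C f"
  using assms unfolding iso_def by (auto simp: hom_def)

lemma isoE:
  assumes "iso C f" "f \<in> hom C a b"
  obtains g where "g \<in> hom C b a" "g \<cdot> f = Id C a" "f \<cdot> g = Id C b"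
  using assms(1) that unfolding iso_def hom_dom[OF assms(2)] hom_cod[OF assms(2)] by blast

lemma iso_comp:
  assumes "iso C f" "iso C g" and f: "f \<in> hom C a b" and g: "g \<in> hom C b c"
  shows "iso C (g \<cdot> f)"
proof -
  obtain f' where f': "f' \<in> hom C b a" "f' \<cdot> f = Id C a" "f \<cdot> f' = Id C b"
    using isoE[OF assms(1) f] .
  obtain g' where g': "g' \<in> hom C c b" "g' \<cdot> g = Id C b" "g \<cdot> g' = Id C c"
    using isoE[OF assms(2) g] .
  have gf: "g \<cdot> f \<in> hom C a c" and fg': "f' \<cdot> g' \<in> hom C c a"
    using comp_hom[OF f g] comp_hom[OF g'(1) f'(1)] .
  have "(f' \<cdot> g') \<cdot> (g \<cdot> f) = f' \<cdot> ((g' \<cdot> g) \<cdot> f)"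
    using comp_assoc[OF gf g'(1) f'(1)] comp_assoc[OF f g g'(1)] by simp
  moreover have "(g \<cdot> f) \<cdot> (f' \<cdot> g') = g \<cdot> ((f \<cdot> f') \<cdot> g')"
    using comp_assoc[OF fg' f g] comp_assoc[OF g'(1) f'(1) f] by simp
  ultimately show ?thesis
    using f'(2,3) g'(2,3) comp_id_left[OF f] comp_id_left[OF g'(1)]
    by (intro isoI[OF gf fg']) auto
qed

lemma iso_inverse:
  assumes "f \<in> hom C a b" "g \<in> hom C b a" "g \<cdot> f = Id C a" "f \<cdot> g = Id C b"
  shows "iso C g"
  using assms isoI by blast

lemma iso_cancel_right:
  assumes "iso C f" "f \<in> hom C a b" "g \<in> hom C b c" "h \<in> hom C b c" "g \<cdot> f = h \<cdot> f"
  shows "g = h"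
proof -
  obtain f' where f': "f' \<in> hom C b a" "f \<cdot> f' = Id C b" using isoE[OF assms(1,2)] by metis
  have "(g \<cdot> f) \<cdot> f' = (h \<cdot> f) \<cdot> f'" using assms by simp
  then show ?thesis 
    using comp_assoc[OF f'(1) assms(2,3)] comp_assoc[OF f'(1) assms(2,4)] f'(2)
      comp_id_right[OF assms(3)] comp_id_right[OF assms(4)] by simp
qed

lemma iso_cancel_left:
  assumes "iso C f" "f \<in> hom C b c" "g \<in> hom C a b" "h \<in> hom C a b" "f \<cdot> g = f \<cdot> h"
  shows "g = h"
proof -
  obtain f' where f': "f' \<in> hom C c b" "f' \<cdot> f = Id C b" using isoE[OF assms(1,2)] by metis
  have "f' \<cdot> (f \<cdot> g) = f' \<cdot> (f \<cdot> h)" using assms by simp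
  then show ?thesis 
    using comp_assoc[OF assms(3,2) f'(1)] comp_assoc[OF assms(4,2) f'(1)] f'(2)
      comp_id_left[OF assms(3)] comp_id_left[OF assms(4)] by simp
qed

lemma iso_two_of_three:
  assumes "iso C f" "iso C (g \<cdot> f)" "f \<in> hom C a b" "g \<in> hom C b c"
  shows "iso C g"
proof -
  obtain f' where f': "f' \<in> hom C b a" "f' \<cdot> f = Id C a" "f \<cdot> f' = Id C b"
    using isoE[OF assms(1,3)] .
  have "g = (g \<cdot> f) \<cdot> f'" 
    using comp_assoc[OF f'(1) assms(3,4)] f'(3) comp_id_right[OF assms(4)] by simp
  moreover have "iso C ((g \<cdot> f) \<cdot> f')"
    using iso_comp[OF iso_inverse[OF assms(3) f'] assms(2) f'(1)] comp_hom assms by blast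
  ultimately show ?thesis by simp
qed

end

lemma initial_isomorphic:
  assumes C: "category C" and z: "initial C z" and i: "isomorphic C x z"
  shows "initial C x"
proof -
  interpret category C by (rule C)
  obtain f where f: "f \<in> hom C x z" and fi: "iso C f" using i by (auto simp: isomorphic_def)
  have "\<exists>!h. h \<in> hom C x y" if y: "y \<in> Obj C" for y
  proof -
    obtain k where k: "k \<in> hom C z y" and uniq: "\<And>k'. k' \<in> hom C z y \<Longrightarrow> k' = k"
      using z y unfolding initial_def by blast
    have "h = k \<cdot>\<^bsub>C\<^esub> f" if h: "h \<in> hom C x y" for h
    proof -
      obtain g where g: "g \<in> hom C z x" "g \<cdot>\<^bsub>C\<^esub> f = Id C x" using isoE[OF fi f] .
      show ?thesis
        using uniq[OF comp_hom[OF g(1) h]] comp_assoc[OF f g(1) h] g(2) comp_id_right[OF h] by simp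
    qed
    then show ?thesis using comp_hom[OF f k] by blast
  qed
  then show ?thesis using hom_obj1[OF f] by (simp add: initial_def)
qed

lemma is_functorI:
  assumes "category C" "category D"
    and "\<And>a. a \<in> Obj C \<Longrightarrow> Omap F a \<in> Obj D"
    and hom: "\<And>a b f. f \<in> hom C a b \<Longrightarrow> Amap F f \<in> hom D (Omap F a) (Omap F b)"
    and "\<And>a. a \<in> Obj C \<Longrightarrow> Amap F (Id C a) = Id D (Omap F a)"
    and comp: "\<And>a b c f g. f \<in> hom C a b \<Longrightarrow> g \<in> hom C b c \<Longrightarrow>
      Amap F (g \<cdot>\<^bsub>C\<^esub> f) = Amap F g \<cdot>\<^bsub>D\<^esub> Amap F f"
  shows "is_functor C D F"
  using assms(1-3,5) unfolding is_functor_def by (auto intro!: hom comp homI)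

lemma
  assumes "is_functor C D F"
  shows functor_dom: "category C"
    and functor_cod: "category D"
    and functor_obj: "a \<in> Obj C \<Longrightarrow> Omap F a \<in> Obj D"
    and functor_hom: "f \<in> hom C a b \<Longrightarrow> Amap F f \<in> hom D (Omap F a) (Omap F b)"
    and functor_id: "a \<in> Obj C \<Longrightarrow> Amap F (Id C a) = Id D (Omap F a)"
    and functor_comp: "f \<in> hom C a b \<Longrightarrow> g \<in> hom C b c \<Longrightarrow>
      Amap F (g \<cdot>\<^bsub>C\<^esub> f) = Amap F g \<cdot>\<^bsub>D\<^esub> Amap F f"
  using assms unfolding is_functor_def by (auto simp: hom_def)

lemma functor_iso:
  assumes F: "is_functor C D F" and "iso C f"
  shows "iso D (Amap F f)"
proof -
  interpret C: category C using functor_dom[OF F] .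
  interpret D: category D using functor_cod[OF F] .
  let ?a = "Dom C f" and ?b = "Cod C f"
  have f: "f \<in> hom C ?a ?b" using assms(2) by (simp add: iso_def hom_def)
  obtain g where g: "g \<in> hom C ?b ?a" "g \<cdot>\<^bsub>C\<^esub> f = Id C ?a" "f \<cdot>\<^bsub>C\<^esub> g = Id C ?b"
    using C.isoE[OF assms(2) f] .
  show ?thesis
    using functor_comp[OF F f g(1)] functor_comp[OF F g(1) f] g(2,3)
      functor_id[OF F C.hom_obj1[OF f]] functor_id[OF F C.hom_obj2[OF f]]
    by (intro D.isoI[OF functor_hom[OF F f] functor_hom[OF F g(1)]]) simp_all
qed

lemma is_functor_id: "category C \<Longrightarrow> is_functor C C id_func"
  by (auto simp: is_functor_def id_func_def hom_def)

lemma is_functor_comp: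
  assumes F: "is_functor C D F" and G: "is_functor D E G"
  shows "is_functor C E (G \<circ>\<^sub>F F)"
  by (rule is_functorI)
    (auto simp: comp_func_def functor_dom[OF F] functor_cod[OF G] functor_obj[OF F] functor_obj[OF G]
      functor_id[OF F] functor_id[OF G] functor_comp[OF F] functor_comp[OF G functor_hom[OF F] functor_hom[OF F]]
      intro: functor_hom[OF F] functor_hom[OF G])

lemma nat_transI:
  assumes "is_functor C D F" "is_functor C D G"
    and "\<And>a. a \<in> Obj C \<Longrightarrow> \<tau> a \<in> hom D (Omap F a) (Omap G a)"
    and nat: "\<And>a b f. f \<in> hom C a b \<Longrightarrow> \<tau> b \<cdot>\<^bsub>D\<^esub> Amap F f = Amap G f \<cdot>\<^bsub>D\<^esub> \<tau> a"
  shows "nat_trans C D F G \<tau>"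
  using assms(1-3) unfolding nat_trans_def by (auto intro!: nat homI)

lemma
  assumes "nat_trans C D F G \<tau>"
  shows nat_trans_hom: "a \<in> Obj C \<Longrightarrow> \<tau> a \<in> hom D (Omap F a) (Omap G a)"
    and nat_trans_nat: "f \<in> hom C a b \<Longrightarrow> \<tau> b \<cdot>\<^bsub>D\<^esub> Amap F f = Amap G f \<cdot>\<^bsub>D\<^esub> \<tau> a"
  using assms unfolding nat_trans_def by (auto simp: hom_def)

lemma nat_iso_nat_trans: "nat_iso C D F G \<tau> \<Longrightarrow> nat_trans C D F G \<tau>"
  and nat_iso_iso: "nat_iso C D F G \<tau> \<Longrightarrow> a \<in> Obj C \<Longrightarrow> iso D (\<tau> a)"
  by (simp_all add: nat_iso_def)

section \<open>Equivalences as fully faithful, essentially surjective functors\<close>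

definition fully_faithful :: "('o, 'm) cat \<Rightarrow> ('p, 'n) cat \<Rightarrow> ('o, 'm, 'p, 'n) func \<Rightarrow> bool" where
  "fully_faithful C D F \<longleftrightarrow> (\<forall>a \<in> Obj C. \<forall>b \<in> Obj C. \<forall>h \<in> hom D (Omap F a) (Omap F b).
     \<exists>!m. m \<in> hom C a b \<and> Amap F m = h)"

definition essentially_surjective ::
  "('o, 'm) cat \<Rightarrow> ('p, 'n) cat \<Rightarrow> ('o, 'm, 'p, 'n) func \<Rightarrow> bool" where
  "essentially_surjective C D F \<longleftrightarrow> (\<forall>d \<in> Obj D. \<exists>c \<in> Obj C. isomorphic D (Omap F c) d)"

text \<open>
  If \<open>F m = F m'\<close>, then naturality gives \<open>\<eta> b \<cdot> m = \<eta> b \<cdot> m'\<close>, and \<open>\<eta> b\<close> cancels. For an equivalence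
  this applies to \<open>F\<close> and, with the roles exchanged, to its inverse.
\<close>

lemma faithful_if_nat_iso_id:
  assumes G: "is_functor D C G" and F: "is_functor C D F"
    and \<eta>: "nat_iso C C id_func (G \<circ>\<^sub>F F) \<eta>"
    and m: "m \<in> hom C a b" "m' \<in> hom C a b" and eq: "Amap F m = Amap F m'"
  shows "m = m'"
proof -
  interpret C: category C using functor_dom[OF F] .
  note \<eta>t = nat_iso_nat_trans[OF \<eta>]
  have "\<eta> b \<cdot>\<^bsub>C\<^esub> m = \<eta> b \<cdot>\<^bsub>C\<^esub> m'"
    using nat_trans_nat[OF \<eta>t m(1)] nat_trans_nat[OF \<eta>t m(2)] eq
    by (simp add: id_func_def comp_func_def)
  moreover have "\<eta> b \<in> hom C b (Omap G (Omap F b))"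
    using nat_trans_hom[OF \<eta>t C.hom_obj2[OF m(1)]] by (simp add: id_func_def comp_func_def)
  ultimately show ?thesis
    using C.iso_cancel_left[OF nat_iso_iso[OF \<eta> C.hom_obj2[OF m(1)]]] m by blast
qed

lemma nat_iso_symmetric_id:
  assumes "nat_iso D D (F \<circ>\<^sub>F G) id_func \<epsilon>"
  shows "\<exists>\<epsilon>'. nat_iso D D id_func (F \<circ>\<^sub>F G) \<epsilon>'"
proof -
  note t = nat_iso_nat_trans[OF assms]
  have FG: "is_functor D D (F \<circ>\<^sub>F G)" and I: "is_functor D D id_func"
    using t by (auto simp: nat_trans_def)
  interpret D: category D using functor_dom[OF I] .
  let ?T = "Omap (F \<circ>\<^sub>F G)"
  have e: "\<epsilon> d \<in> hom D (?T d) d" if "d \<in> Obj D" for d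
    using nat_trans_hom[OF t that] by (simp add: id_func_def)
  have "\<exists>g. g \<in> hom D d (?T d) \<and> g \<cdot>\<^bsub>D\<^esub> \<epsilon> d = Id D (?T d) \<and> \<epsilon> d \<cdot>\<^bsub>D\<^esub> g = Id D d"
    if "d \<in> Obj D" for d
    using D.isoE[OF nat_iso_iso[OF assms that] e[OF that]] by metis
  then obtain i where i: "\<And>d. d \<in> Obj D \<Longrightarrow> i d \<in> hom D d (?T d)"
      "\<And>d. d \<in> Obj D \<Longrightarrow> i d \<cdot>\<^bsub>D\<^esub> \<epsilon> d = Id D (?T d)"
      "\<And>d. d \<in> Obj D \<Longrightarrow> \<epsilon> d \<cdot>\<^bsub>D\<^esub> i d = Id D d" by metis
  have "nat_iso D D id_func (F \<circ>\<^sub>F G) i" unfolding nat_iso_def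
  proof (intro conjI ballI nat_transI[OF I FG])
    fix d d' f assume f: "f \<in> hom D d d'"
    have d: "d \<in> Obj D" "d' \<in> Obj D" using f by (auto intro: D.hom_obj1 D.hom_obj2)
    let ?Tf = "Amap (F \<circ>\<^sub>F G) f"
    have Tf: "?Tf \<in> hom D (?T d) (?T d')" using functor_hom[OF FG f] .
    have "\<epsilon> d' \<cdot>\<^bsub>D\<^esub> (i d' \<cdot>\<^bsub>D\<^esub> f) = f"
      
      using D.comp_assoc[OF f i(1)[OF d(2)] e[OF d(2)]] i(3)[OF d(2)] D.comp_id_left[OF f] by simp
    moreover have "\<epsilon> d' \<cdot>\<^bsub>D\<^esub> (?Tf \<cdot>\<^bsub>D\<^esub> i d) = (f \<cdot>\<^bsub>D\<^esub> \<epsilon> d) \<cdot>\<^bsub>D\<^esub> i d"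
      using nat_trans_nat[OF t f] D.comp_assoc[OF i(1)[OF d(1)] Tf e[OF d(2)]]
      by (simp add: id_func_def)
    moreover have "(f \<cdot>\<^bsub>D\<^esub> \<epsilon> d) \<cdot>\<^bsub>D\<^esub> i d = f"
      
      using D.comp_assoc[OF i(1)[OF d(1)] e[OF d(1)] f] i(3)[OF d(1)] D.comp_id_right[OF f] by simp
    ultimately have "i d' \<cdot>\<^bsub>D\<^esub> f = ?Tf \<cdot>\<^bsub>D\<^esub> i d"
      using D.iso_cancel_left[OF nat_iso_iso[OF assms d(2)] e[OF d(2)]]
        D.comp_hom[OF f i(1)[OF d(2)]] D.comp_hom[OF i(1)[OF d(1)] Tf] by simp
    then show "i d' \<cdot>\<^bsub>D\<^esub> Amap id_func f = ?Tf \<cdot>\<^bsub>D\<^esub> i d" by (simp add: id_func_def)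
  next
    fix d assume d: "d \<in> Obj D"
    show "i d \<in> hom D (Omap id_func d) (?T d)" using i(1)[OF d] by (simp add: id_func_def)
    show "iso D (i d)" using D.iso_inverse[OF e[OF d] i(1)[OF d]] i d by blast
  qed
  then show ?thesis by blast
qed

text \<open>
  Only fullness takes work: the preimage of \<open>h\<close> is \<open>G h\<close> conjugated by \<open>\<eta>\<close>, and that \<open>F\<close> maps it
  to \<open>h\<close> can be checked after applying the faithful functor \<open>G\<close>.
\<close>

lemma equivalence_imp_ff_es:
  assumes "is_equivalence C D F"
  shows "fully_faithful C D F" "essentially_surjective C D F"
proof -
  obtain G \<eta> \<epsilon> where F: "is_functor C D F" and G: "is_functor D C G"
    and \<eta>: "nat_iso C C id_func (G \<circ>\<^sub>F F) \<eta>" and \<epsilon>: "nat_iso D D (F \<circ>\<^sub>F G) id_func \<epsilon>"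
    using assms by (auto simp: is_equivalence_def)
  interpret C: category C using functor_dom[OF F] .
  interpret D: category D using functor_cod[OF F] .
  obtain \<epsilon>' where \<epsilon>': "nat_iso D D id_func (F \<circ>\<^sub>F G) \<epsilon>'"
    using nat_iso_symmetric_id[OF \<epsilon>] by blast
  note \<eta>t = nat_iso_nat_trans[OF \<eta>]
  have \<eta>h: "\<eta> c \<in> hom C c (Omap G (Omap F c))" if "c \<in> Obj C" for c
    using nat_trans_hom[OF \<eta>t that] by (simp add: id_func_def comp_func_def)
  show "essentially_surjective C D F" unfolding essentially_surjective_def
  proof
    fix d assume d: "d \<in> Obj D"
    have "\<epsilon> d \<in> hom D (Omap F (Omap G d)) d"
      using nat_trans_hom[OF nat_iso_nat_trans[OF \<epsilon>] d] by (simp add: id_func_def comp_func_def)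
    then show "\<exists>c \<in> Obj C. isomorphic D (Omap F c) d"
      using functor_obj[OF G d] nat_iso_iso[OF \<epsilon> d] unfolding isomorphic_def by blast
  qed
  show "fully_faithful C D F" unfolding fully_faithful_def
  proof (intro ballI ex_ex1I)
    fix a b h assume a: "a \<in> Obj C" and b: "b \<in> Obj C" and h: "h \<in> hom D (Omap F a) (Omap F b)"
    obtain i where i: "i \<in> hom C (Omap G (Omap F b)) b" "\<eta> b \<cdot>\<^bsub>C\<^esub> i = Id C (Omap G (Omap F b))"
      using C.isoE[OF nat_iso_iso[OF \<eta> b] \<eta>h[OF b]] by metis
    let ?m = "i \<cdot>\<^bsub>C\<^esub> (Amap G h \<cdot>\<^bsub>C\<^esub> \<eta> a)"
    have Gh: "Amap G h \<in> hom C (Omap G (Omap F a)) (Omap G (Omap F b))" using functor_hom[OF G h] .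
    have m: "?m \<in> hom C a b" using C.comp_hom[OF C.comp_hom[OF \<eta>h[OF a] Gh] i(1)] .
    have Fm: "Amap F ?m \<in> hom D (Omap F a) (Omap F b)" using functor_hom[OF F m] .
    have "\<eta> b \<cdot>\<^bsub>C\<^esub> ?m = Amap G h \<cdot>\<^bsub>C\<^esub> \<eta> a"
      using C.comp_assoc[OF C.comp_hom[OF \<eta>h[OF a] Gh] i(1) \<eta>h[OF b]] i(2)
        C.comp_id_left[OF C.comp_hom[OF \<eta>h[OF a] Gh]] by simp
    then have "Amap G (Amap F ?m) \<cdot>\<^bsub>C\<^esub> \<eta> a = Amap G h \<cdot>\<^bsub>C\<^esub> \<eta> a"
      using nat_trans_nat[OF \<eta>t m] by (simp add: id_func_def comp_func_def)
    then have "Amap G (Amap F ?m) = Amap G h"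
      using C.iso_cancel_right[OF nat_iso_iso[OF \<eta> a] \<eta>h[OF a] functor_hom[OF G Fm] Gh] by simp
    then have "Amap F ?m = h" using faithful_if_nat_iso_id[OF F G \<epsilon>' Fm h] by simp
    then show "\<exists>m. m \<in> hom C a b \<and> Amap F m = h" using m by blast
  next
    fix a b h m m' assume "m \<in> hom C a b \<and> Amap F m = h" "m' \<in> hom C a b \<and> Amap F m' = h"
    then show "m = m'" using faithful_if_nat_iso_id[OF G F \<eta>] by auto
  qed
qed

text \<open>
  Choose for every \<open>d\<close> an object \<open>g d\<close> and an isomorphism \<open>t d : F (g d) \<rightarrow> d\<close>. There is exactly one
  way to extend \<open>g\<close> to arrows that makes \<open>t\<close> natural, and uniqueness gives functoriality. The unit at
  \<open>c\<close> is the preimage of the inverse of \<open>t (F c)\<close>.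
\<close>

lemma equivalence_if_ff_es:
  assumes F: "is_functor C D F" and ff: "fully_faithful C D F"
    and es: "essentially_surjective C D F"
  shows "is_equivalence C D F"
proof -
  interpret C: category C using functor_dom[OF F] .
  interpret D: category D using functor_cod[OF F] .
  have "\<exists>c t. c \<in> Obj C \<and> t \<in> hom D (Omap F c) d \<and> iso D t" if "d \<in> Obj D" for d
    using es that unfolding essentially_surjective_def isomorphic_def by blast
  then obtain g t where g: "\<And>d. d \<in> Obj D \<Longrightarrow> g d \<in> Obj C"
    and t: "\<And>d. d \<in> Obj D \<Longrightarrow> t d \<in> hom D (Omap F (g d)) d"
    and ti: "\<And>d. d \<in> Obj D \<Longrightarrow> iso D (t d)" by metis
  have full: "\<exists>m. m \<in> hom C a b \<and> Amap F m = h"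
    if "a \<in> Obj C" "b \<in> Obj C" "h \<in> hom D (Omap F a) (Omap F b)" for a b h
    using ff that unfolding fully_faithful_def by blast
  have faith: "m = m'" if "m \<in> hom C a b" "m' \<in> hom C a b" "Amap F m = Amap F m'" for a b m m'
    using ff that C.hom_obj1[OF that(1)] C.hom_obj2[OF that(1)] functor_hom[OF F that(1)]
    unfolding fully_faithful_def by metis
  have "\<exists>m. m \<in> hom C (g d) (g d') \<and> t d' \<cdot>\<^bsub>D\<^esub> Amap F m = h \<cdot>\<^bsub>D\<^esub> t d"
    if h: "h \<in> hom D d d'" for d d' h
  proof -
    have d: "d \<in> Obj D" "d' \<in> Obj D" using h by (auto intro: D.hom_obj1 D.hom_obj2)
    obtain s where s: "s \<in> hom D d' (Omap F (g d'))" "t d' \<cdot>\<^bsub>D\<^esub> s = Id D d'"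
      using D.isoE[OF ti[OF d(2)] t[OF d(2)]] by metis
    have ht: "h \<cdot>\<^bsub>D\<^esub> t d \<in> hom D (Omap F (g d)) d'" using D.comp_hom[OF t[OF d(1)] h] .
    obtain m where "m \<in> hom C (g d) (g d')" "Amap F m = s \<cdot>\<^bsub>D\<^esub> (h \<cdot>\<^bsub>D\<^esub> t d)"
      using full[OF g[OF d(1)] g[OF d(2)] D.comp_hom[OF ht s(1)]] by blast
    moreover have "t d' \<cdot>\<^bsub>D\<^esub> (s \<cdot>\<^bsub>D\<^esub> (h \<cdot>\<^bsub>D\<^esub> t d)) = h \<cdot>\<^bsub>D\<^esub> t d"
      using D.comp_assoc[OF ht s(1) t[OF d(2)]] s(2) D.comp_id_left[OF ht] by simp
    ultimately show ?thesis by auto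
  qed
  then have "\<exists>m. h \<in> Arr D \<longrightarrow> m \<in> hom C (g (Dom D h)) (g (Cod D h)) \<and>
      t (Cod D h) \<cdot>\<^bsub>D\<^esub> Amap F m = h \<cdot>\<^bsub>D\<^esub> t (Dom D h)" for h
    by (cases "h \<in> Arr D") (auto simp: hom_def)
  then obtain k where k: "\<And>h. h \<in> Arr D \<Longrightarrow> k h \<in> hom C (g (Dom D h)) (g (Cod D h)) \<and>
      t (Cod D h) \<cdot>\<^bsub>D\<^esub> Amap F (k h) = h \<cdot>\<^bsub>D\<^esub> t (Dom D h)" by metis
  have kh: "k h \<in> hom C (g d) (g d')" and kt: "t d' \<cdot>\<^bsub>D\<^esub> Amap F (k h) = h \<cdot>\<^bsub>D\<^esub> t d"
    if "h \<in> hom D d d'" for h d d'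
    using k[of h] that by (auto simp: hom_def)
  have keq: "k h = m" if h: "h \<in> hom D d d'" and m: "m \<in> hom C (g d) (g d')"
    and eq: "t d' \<cdot>\<^bsub>D\<^esub> Amap F m = h \<cdot>\<^bsub>D\<^esub> t d" for h d d' m
    using faith[OF kh[OF h] m] kt[OF h] eq
      D.iso_cancel_left[OF ti t functor_hom[OF F kh[OF h]] functor_hom[OF F m]] D.hom_obj2[OF h] by simp
  let ?G = "\<lparr>Omap = g, Amap = k\<rparr>"
  have G: "is_functor D C ?G"
  proof (rule is_functorI, goal_cases)
    case (5 d)
    have "k (Id D d) = Id C (g d)"
      using keq[OF D.id_hom[OF 5] C.id_hom[OF g[OF 5]]] functor_id[OF F g[OF 5]]
        D.comp_id_right[OF t[OF 5]] D.comp_id_left[OF t[OF 5]] by simp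
    then show ?case by simp
  next
    case (6 a b c f h)
    have o: "a \<in> Obj D" "b \<in> Obj D" "c \<in> Obj D"
      using 6 by (auto intro: D.hom_obj1 D.hom_obj2)
    note Ff = functor_hom[OF F kh[OF 6(1)]] and Fh = functor_hom[OF F kh[OF 6(2)]]
    have "t c \<cdot>\<^bsub>D\<^esub> Amap F (k h \<cdot>\<^bsub>C\<^esub> k f) = t c \<cdot>\<^bsub>D\<^esub> (Amap F (k h) \<cdot>\<^bsub>D\<^esub> Amap F (k f))"
      using functor_comp[OF F kh[OF 6(1)] kh[OF 6(2)]] by simp
    also have "\<dots> = (h \<cdot>\<^bsub>D\<^esub> t b) \<cdot>\<^bsub>D\<^esub> Amap F (k f)"
      using D.comp_assoc[OF Ff Fh t[OF o(3)]] kt[OF 6(2)] by simp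
    also have "\<dots> = h \<cdot>\<^bsub>D\<^esub> (f \<cdot>\<^bsub>D\<^esub> t a)"
      using D.comp_assoc[OF Ff t[OF o(2)] 6(2)] kt[OF 6(1)] by simp
    also have "\<dots> = (h \<cdot>\<^bsub>D\<^esub> f) \<cdot>\<^bsub>D\<^esub> t a"
      using D.comp_assoc[OF t[OF o(1)] 6(1,2)] by simp
    finally show ?case
      using keq[OF D.comp_hom[OF 6(1,2)] C.comp_hom[OF kh[OF 6(1)] kh[OF 6(2)]]] by simp
  qed (auto simp: g kh C.category_axioms D.category_axioms)
  have "nat_trans D D (F \<circ>\<^sub>F ?G) id_func t"
    by (rule nat_transI[OF is_functor_comp[OF G F] is_functor_id[OF D.category_axioms]])
      (auto simp: comp_func_def id_func_def t kt)
  then have \<epsilon>: "nat_iso D D (F \<circ>\<^sub>F ?G) id_func t" using ti by (simp add: nat_iso_def)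
  have "\<exists>e e'. e \<in> hom C c (g (Omap F c)) \<and> e' \<in> hom C (g (Omap F c)) c \<and>
      e' \<cdot>\<^bsub>C\<^esub> e = Id C c \<and> e \<cdot>\<^bsub>C\<^esub> e' = Id C (g (Omap F c)) \<and>
      t (Omap F c) \<cdot>\<^bsub>D\<^esub> Amap F e = Id D (Omap F c)"
    if c: "c \<in> Obj C" for c
  proof -
    let ?d = "Omap F c"
    have d: "?d \<in> Obj D" using functor_obj[OF F c] .
    obtain s where s: "s \<in> hom D ?d (Omap F (g ?d))" "s \<cdot>\<^bsub>D\<^esub> t ?d = Id D (Omap F (g ?d))"
        "t ?d \<cdot>\<^bsub>D\<^esub> s = Id D ?d" using D.isoE[OF ti[OF d] t[OF d]] .
    obtain e where e: "e \<in> hom C c (g ?d)" "Amap F e = s" using full[OF c g[OF d] s(1)] by blast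
    obtain e' where e': "e' \<in> hom C (g ?d) c" "Amap F e' = t ?d" using full[OF g[OF d] c t[OF d]] by blast
    have "e' \<cdot>\<^bsub>C\<^esub> e = Id C c"
      by (rule faith[OF C.comp_hom[OF e(1) e'(1)] C.id_hom[OF c]])
        (simp add: functor_comp[OF F e(1) e'(1)] functor_id[OF F c] e e' s)
    moreover have "e \<cdot>\<^bsub>C\<^esub> e' = Id C (g ?d)"
      by (rule faith[OF C.comp_hom[OF e'(1) e(1)] C.id_hom[OF g[OF d]]])
        (simp add: functor_comp[OF F e'(1) e(1)] functor_id[OF F g[OF d]] e e' s)
    ultimately show ?thesis using e e' s by auto
  qed
  then obtain e e' where e: "\<And>c. c \<in> Obj C \<Longrightarrow> e c \<in> hom C c (g (Omap F c))"
    and e': "\<And>c. c \<in> Obj C \<Longrightarrow> e' c \<in> hom C (g (Omap F c)) c \<and>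
      e' c \<cdot>\<^bsub>C\<^esub> e c = Id C c \<and> e c \<cdot>\<^bsub>C\<^esub> e' c = Id C (g (Omap F c))"
    and te: "\<And>c. c \<in> Obj C \<Longrightarrow> t (Omap F c) \<cdot>\<^bsub>D\<^esub> Amap F (e c) = Id D (Omap F c)" by metis
  have "nat_trans C C id_func (?G \<circ>\<^sub>F F) e"
  proof (rule nat_transI[OF is_functor_id[OF C.category_axioms] is_functor_comp[OF F G]], goal_cases)
    case (2 a b f)
    have o: "a \<in> Obj C" "b \<in> Obj C" using 2 by (auto intro: C.hom_obj1 C.hom_obj2)
    let ?Ff = "Amap F f"
    have Ff: "?Ff \<in> hom D (Omap F a) (Omap F b)" using functor_hom[OF F 2] .
    note Fea = functor_hom[OF F e[OF o(1)]] and Feb = functor_hom[OF F e[OF o(2)]]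
      and tb = t[OF functor_obj[OF F o(2)]] and ta = t[OF functor_obj[OF F o(1)]]
      and kf = kh[OF Ff]
    note Fkf = functor_hom[OF F kf]
    have "t (Omap F b) \<cdot>\<^bsub>D\<^esub> Amap F (e b \<cdot>\<^bsub>C\<^esub> f) = ?Ff"
      using functor_comp[OF F 2 e[OF o(2)]] D.comp_assoc[OF Ff Feb tb] te[OF o(2)] D.comp_id_left[OF Ff]
      by simp
    moreover have "t (Omap F b) \<cdot>\<^bsub>D\<^esub> Amap F (k ?Ff \<cdot>\<^bsub>C\<^esub> e a) = ?Ff"
      using functor_comp[OF F e[OF o(1)] kf] D.comp_assoc[OF Fea Fkf tb] kt[OF Ff]
        D.comp_assoc[OF Fea ta Ff] te[OF o(1)] D.comp_id_right[OF Ff] by simp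
    ultimately have "e b \<cdot>\<^bsub>C\<^esub> f = k ?Ff \<cdot>\<^bsub>C\<^esub> e a"
      using faith[OF C.comp_hom[OF 2 e[OF o(2)]] C.comp_hom[OF e[OF o(1)] kf]]
        D.iso_cancel_left[OF ti[OF functor_obj[OF F o(2)]] tb
          functor_hom[OF F C.comp_hom[OF 2 e[OF o(2)]]] functor_hom[OF F C.comp_hom[OF e[OF o(1)] kf]]]
      by simp
    then show ?case by (simp add: comp_func_def id_func_def)
  qed (simp add: comp_func_def id_func_def e)
  then have "nat_iso C C id_func (?G \<circ>\<^sub>F F) e"
    unfolding nat_iso_def using C.isoI[OF e] e' by blast
  then show ?thesis using F G \<epsilon> unfolding is_equivalence_def by blast
qed

section \<open>Monadic adjunctions\<close>

locale adjoint_pair =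
  fixes C :: "('o, 'm) cat" and D :: "('p, 'n) cat"
    and F :: "('o, 'm, 'p, 'n) func" and G :: "('p, 'n, 'o, 'm) func"
    and \<eta> :: "'o \<Rightarrow> 'm" and \<epsilon> :: "'p \<Rightarrow> 'n"
  assumes adj: "adjunction C D F G \<eta> \<epsilon>"
begin

lemma F: "is_functor C D F" and G: "is_functor D C G"
  using adj by (simp_all add: adjunction_def)

sublocale C: category C using functor_dom[OF F] .
sublocale D: category D using functor_cod[OF F] .

lemma unit_trans: "nat_trans C C id_func (G \<circ>\<^sub>F F) \<eta>"
  and counit_trans: "nat_trans D D (F \<circ>\<^sub>F G) id_func \<epsilon>"
  using adj by (simp_all add: adjunction_def)

lemma unit_hom: "x \<in> Obj C \<Longrightarrow> \<eta> x \<in> hom C x (Omap G (Omap F x))"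
  using nat_trans_hom[OF unit_trans] by (simp add: comp_func_def id_func_def)

lemma unit_nat: "f \<in> hom C a b \<Longrightarrow> \<eta> b \<cdot>\<^bsub>C\<^esub> f = Amap G (Amap F f) \<cdot>\<^bsub>C\<^esub> \<eta> a"
  using nat_trans_nat[OF unit_trans] by (simp add: comp_func_def id_func_def)

lemma counit_hom: "y \<in> Obj D \<Longrightarrow> \<epsilon> y \<in> hom D (Omap F (Omap G y)) y"
  using nat_trans_hom[OF counit_trans] by (simp add: comp_func_def id_func_def)

lemma counit_nat: "f \<in> hom D a b \<Longrightarrow> \<epsilon> b \<cdot>\<^bsub>D\<^esub> Amap F (Amap G f) = f \<cdot>\<^bsub>D\<^esub> \<epsilon> a"
  using nat_trans_nat[OF counit_trans] by (simp add: comp_func_def id_func_def)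

lemma triangle_left: "x \<in> Obj C \<Longrightarrow> \<epsilon> (Omap F x) \<cdot>\<^bsub>D\<^esub> Amap F (\<eta> x) = Id D (Omap F x)"
  and triangle_right: "y \<in> Obj D \<Longrightarrow> Amap G (\<epsilon> y) \<cdot>\<^bsub>C\<^esub> \<eta> (Omap G y) = Id C (Omap G y)"
  using adj by (simp_all add: adjunction_def)

lemma ex1_transpose:
  assumes x: "x \<in> Obj C" and y: "y \<in> Obj D" and f: "f \<in> hom D (Omap F x) y"
  shows "\<exists>!h. h \<in> hom C x (Omap G y) \<and> \<epsilon> y \<cdot>\<^bsub>D\<^esub> Amap F h = f"
proof (rule ex_ex1I)
  note Gf = functor_hom[OF G f] and ux = unit_hom[OF x]
  have "\<epsilon> y \<cdot>\<^bsub>D\<^esub> Amap F (Amap G f \<cdot>\<^bsub>C\<^esub> \<eta> x) = (\<epsilon> y \<cdot>\<^bsub>D\<^esub> Amap F (Amap G f)) \<cdot>\<^bsub>D\<^esub> Amap F (\<eta> x)"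
    using functor_comp[OF F ux Gf]
      D.comp_assoc[OF functor_hom[OF F ux] functor_hom[OF F Gf] counit_hom[OF y]] by simp
  also have "\<dots> = f"
    using counit_nat[OF f] triangle_left[OF x] D.comp_id_right[OF f]
      D.comp_assoc[OF functor_hom[OF F ux] counit_hom[OF functor_obj[OF F x]] f] by simp
  finally show "\<exists>h. h \<in> hom C x (Omap G y) \<and> \<epsilon> y \<cdot>\<^bsub>D\<^esub> Amap F h = f"
    using C.comp_hom[OF ux Gf] by blast
next
  fix h h' assume h: "h \<in> hom C x (Omap G y) \<and> \<epsilon> y \<cdot>\<^bsub>D\<^esub> Amap F h = f"
    and h': "h' \<in> hom C x (Omap G y) \<and> \<epsilon> y \<cdot>\<^bsub>D\<^esub> Amap F h' = f"
  have "h = Amap G (\<epsilon> y \<cdot>\<^bsub>D\<^esub> Amap F h) \<cdot>\<^bsub>C\<^esub> \<eta> x" if h: "h \<in> hom C x (Omap G y)" for h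
  proof -
    note Fh = functor_hom[OF F h] and ey = counit_hom[OF y]
    have "Amap G (\<epsilon> y \<cdot>\<^bsub>D\<^esub> Amap F h) \<cdot>\<^bsub>C\<^esub> \<eta> x
        = Amap G (\<epsilon> y) \<cdot>\<^bsub>C\<^esub> (Amap G (Amap F h) \<cdot>\<^bsub>C\<^esub> \<eta> x)"
      using functor_comp[OF G Fh ey]
        C.comp_assoc[OF unit_hom[OF x] functor_hom[OF G Fh] functor_hom[OF G ey]] by simp
    also have "\<dots> = h"
      using unit_nat[OF h] triangle_right[OF y] C.comp_id_left[OF h]
        C.comp_assoc[OF h unit_hom[OF functor_obj[OF G y]] functor_hom[OF G ey]] by simp
    finally show ?thesis by simp
  qed
  from this[of h] this[of h'] show "h = h'" using h h' by simp
qed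

text \<open>
  Algebras of the induced monad and their morphisms as predicates on objects and arrows of the base
  category, so that calculations need not handle the triples of the Eilenberg-Moore category.
\<close>

definition alg :: "'o \<Rightarrow> 'm \<Rightarrow> bool" where
  "alg x \<alpha> \<longleftrightarrow> x \<in> Obj C \<and> \<alpha> \<in> hom C (Omap G (Omap F x)) x \<and>
     \<alpha> \<cdot>\<^bsub>C\<^esub> \<eta> x = Id C x \<and> \<alpha> \<cdot>\<^bsub>C\<^esub> Amap G (\<epsilon> (Omap F x)) = \<alpha> \<cdot>\<^bsub>C\<^esub> Amap G (Amap F \<alpha>)"

definition alg_hom :: "'o \<Rightarrow> 'm \<Rightarrow> 'o \<Rightarrow> 'm \<Rightarrow> 'm \<Rightarrow> bool" where
  "alg_hom x \<alpha> y \<beta> f \<longleftrightarrow> f \<in> hom C x y \<and> f \<cdot>\<^bsub>C\<^esub> \<alpha> = \<beta> \<cdot>\<^bsub>C\<^esub> Amap G (Amap F f)"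

abbreviation EM where "EM \<equiv> induced_em_category C F G \<eta> \<epsilon>"

lemma EM_Obj: "(x, \<alpha>) \<in> Obj EM \<longleftrightarrow> alg x \<alpha>"
  by (simp add: induced_em_category_def em_category_def em_algebras_def alg_def comp_func_def)

lemma EM_hom: "m \<in> hom EM (x, \<alpha>) (y, \<beta>) \<longleftrightarrow>
    alg x \<alpha> \<and> alg y \<beta> \<and> (\<exists>f. alg_hom x \<alpha> y \<beta> f \<and> m = ((x, \<alpha>), f, (y, \<beta>)))"
  by (auto simp: induced_em_category_def em_category_def em_algebras_def alg_def comp_func_def
      hom_def alg_hom_def)

lemma EM_Id: "Id EM (x, \<alpha>) = ((x, \<alpha>), Id C x, (x, \<alpha>))"
  and EM_Comp: "(Y, g, Z) \<cdot>\<^bsub>EM\<^esub> (X, f, Y') = (X, g \<cdot>\<^bsub>C\<^esub> f, Z)"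
  by (simp_all add: induced_em_category_def em_category_def)

lemma EM_Arr: "f \<in> Arr EM \<Longrightarrow> Dom EM f \<in> Obj EM" "f \<in> Arr EM \<Longrightarrow> Cod EM f \<in> Obj EM"
  by (auto simp: induced_em_category_def em_category_def)

lemma alg_hom_id: "alg x \<alpha> \<Longrightarrow> alg_hom x \<alpha> x \<alpha> (Id C x)"
  unfolding alg_def alg_hom_def
  by (auto simp: C.id_hom functor_id[OF F] functor_id[OF G] functor_obj[OF F] C.comp_id_left C.comp_id_right)

lemma alg_hom_comp:
  assumes "alg x \<alpha>" "alg y \<beta>" "alg z \<gamma>" "alg_hom x \<alpha> y \<beta> f" "alg_hom y \<beta> z \<gamma> g"
  shows "alg_hom x \<alpha> z \<gamma> (g \<cdot>\<^bsub>C\<^esub> f)"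
proof -
  have h: "f \<in> hom C x y" "g \<in> hom C y z" and a: "\<alpha> \<in> hom C (Omap G (Omap F x)) x"
      "\<beta> \<in> hom C (Omap G (Omap F y)) y" "\<gamma> \<in> hom C (Omap G (Omap F z)) z"
    and e: "f \<cdot>\<^bsub>C\<^esub> \<alpha> = \<beta> \<cdot>\<^bsub>C\<^esub> Amap G (Amap F f)" "g \<cdot>\<^bsub>C\<^esub> \<beta> = \<gamma> \<cdot>\<^bsub>C\<^esub> Amap G (Amap F g)"
    using assms by (auto simp: alg_def alg_hom_def)
  note Ff = functor_hom[OF F h(1)] and Fg = functor_hom[OF F h(2)]
  note Tf = functor_hom[OF G Ff] and Tg = functor_hom[OF G Fg]
  have "(g \<cdot>\<^bsub>C\<^esub> f) \<cdot>\<^bsub>C\<^esub> \<alpha> = (g \<cdot>\<^bsub>C\<^esub> \<beta>) \<cdot>\<^bsub>C\<^esub> Amap G (Amap F f)"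
    using C.comp_assoc[OF a(1) h] C.comp_assoc[OF Tf a(2) h(2)] e(1) by simp
  also have "\<dots> = \<gamma> \<cdot>\<^bsub>C\<^esub> Amap G (Amap F (g \<cdot>\<^bsub>C\<^esub> f))"
    using C.comp_assoc[OF Tf Tg a(3)] e(2) functor_comp[OF F h] functor_comp[OF G Ff Fg] by simp
  finally show ?thesis using C.comp_hom[OF h] by (simp add: alg_hom_def)
qed

lemma EM_category: "category EM"
proof (unfold_locales, goal_cases)
  case (3 X) then show ?case
    by (cases X) (auto simp: EM_Obj EM_hom EM_Id alg_hom_id)
next
  case (4 f X Y g Z) then show ?case
    by (cases X; cases Y; cases Z) (auto simp: EM_hom EM_Comp intro: alg_hom_comp)
next
  case (5 f X Y g Z h W)
  obtain f' g' h' where m: "f = (X, f', Y)" "g = (Y, g', Z)" "h = (Z, h', W)"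
      "f' \<in> hom C (fst X) (fst Y)" "g' \<in> hom C (fst Y) (fst Z)" "h' \<in> hom C (fst Z) (fst W)"
    using 5 by (cases X; cases Y; cases Z; cases W) (auto simp: EM_hom alg_hom_def)
  then show ?case using C.comp_assoc[OF m(4-6)] by (simp add: EM_Comp)
next
  case (6 f X Y) then show ?case
    by (cases X; cases Y) (auto simp: EM_hom EM_Comp EM_Id alg_hom_def C.comp_id_left)
next
  case (7 f X Y) then show ?case
    by (cases X; cases Y) (auto simp: EM_hom EM_Comp EM_Id alg_hom_def C.comp_id_right)
qed (auto simp: EM_Arr)

lemma alg_free:
  assumes y: "y \<in> Obj D"
  shows "alg (Omap G y) (Amap G (\<epsilon> y))"
proof -
  note ey = counit_hom[OF y]
  note eFG = counit_hom[OF functor_obj[OF F functor_obj[OF G y]]]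
  have "Amap G (\<epsilon> y) \<cdot>\<^bsub>C\<^esub> Amap G (\<epsilon> (Omap F (Omap G y)))
      = Amap G (\<epsilon> y) \<cdot>\<^bsub>C\<^esub> Amap G (Amap F (Amap G (\<epsilon> y)))"
    using functor_comp[OF G eFG ey] functor_comp[OF G functor_hom[OF F functor_hom[OF G ey]] ey]
      counit_nat[OF ey] by simp
  then show ?thesis
    using functor_obj[OF G y] functor_hom[OF G ey] triangle_right[OF y] by (simp add: alg_def)
qed

lemma alg_hom_free:
  assumes f: "f \<in> hom D y z"
  shows "alg_hom (Omap G y) (Amap G (\<epsilon> y)) (Omap G z) (Amap G (\<epsilon> z)) (Amap G f)"
proof -
  note o = D.hom_obj1[OF f] D.hom_obj2[OF f]
  show ?thesis
    using functor_comp[OF G counit_hom[OF o(1)] f] counit_nat[OF f]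
      functor_comp[OF G functor_hom[OF F functor_hom[OF G f]] counit_hom[OF o(2)]]
      functor_hom[OF G f] by (simp add: alg_hom_def)
qed

abbreviation K where "K \<equiv> comparison_functor D G \<epsilon>"

lemma K_Omap: "Omap K y = (Omap G y, Amap G (\<epsilon> y))"
  and K_Amap: "f \<in> hom D y z \<Longrightarrow> Amap K f = (Omap K y, Amap G f, Omap K z)"
  by (simp_all add: comparison_functor_def hom_def)

lemma K_functor: "is_functor D EM K"
proof (rule is_functorI[OF D.category_axioms EM_category], goal_cases)
  case (1 a) then show ?case by (simp add: K_Omap EM_Obj alg_free)
next
  case (2 a b f) then show ?case
    using D.hom_obj1[OF 2] D.hom_obj2[OF 2]
    by (simp add: K_Omap K_Amap[OF 2] EM_hom alg_free alg_hom_free)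
next
  case (3 a) then show ?case
    by (simp add: K_Omap K_Amap[OF D.id_hom[OF 3]] EM_Id functor_id[OF G 3])
next
  case (4 a b c f g) then show ?case
    by (simp add: K_Amap[OF 4(1)] K_Amap[OF 4(2)] K_Amap[OF D.comp_hom[OF 4]] EM_Comp
        functor_comp[OF G 4])
qed

text \<open>The inverse of an invertible algebra morphism is again an algebra morphism.\<close>

lemma EM_isomorphic_iff:
  assumes X: "alg x \<alpha>" and Y: "alg y \<beta>"
  shows "isomorphic EM (x, \<alpha>) (y, \<beta>) \<longleftrightarrow> (\<exists>f. alg_hom x \<alpha> y \<beta> f \<and> iso C f)"
proof
  interpret EM: category EM by (rule EM_category)
  assume "isomorphic EM (x, \<alpha>) (y, \<beta>)"
  then obtain m where m: "m \<in> hom EM (x, \<alpha>) (y, \<beta>)" "iso EM m" by (auto simp: isomorphic_def)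
  obtain n where n: "n \<in> hom EM (y, \<beta>) (x, \<alpha>)" "n \<cdot>\<^bsub>EM\<^esub> m = Id EM (x, \<alpha>)"
      "m \<cdot>\<^bsub>EM\<^esub> n = Id EM (y, \<beta>)" using EM.isoE[OF m(2,1)] .
  obtain f g where f: "alg_hom x \<alpha> y \<beta> f" "m = ((x, \<alpha>), f, (y, \<beta>))"
    and g: "alg_hom y \<beta> x \<alpha> g" "n = ((y, \<beta>), g, (x, \<alpha>))"
    using m(1) n(1) by (auto simp: EM_hom)
  have "iso C f"
    using f g n(2,3) by (intro C.isoI[of f x y g]) (auto simp: EM_Comp EM_Id alg_hom_def)
  then show "\<exists>f. alg_hom x \<alpha> y \<beta> f \<and> iso C f" using f by blast
next
  interpret EM: category EM by (rule EM_category)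
  assume "\<exists>f. alg_hom x \<alpha> y \<beta> f \<and> iso C f"
  then obtain f where f: "f \<in> hom C x y" "f \<cdot>\<^bsub>C\<^esub> \<alpha> = \<beta> \<cdot>\<^bsub>C\<^esub> Amap G (Amap F f)" and fi: "iso C f"
    by (auto simp: alg_hom_def)
  obtain g where g: "g \<in> hom C y x" "g \<cdot>\<^bsub>C\<^esub> f = Id C x" "f \<cdot>\<^bsub>C\<^esub> g = Id C y"
    using C.isoE[OF fi f(1)] .
  have a: "\<alpha> \<in> hom C (Omap G (Omap F x)) x" "\<beta> \<in> hom C (Omap G (Omap F y)) y"
    and o: "x \<in> Obj C" "y \<in> Obj C" using X Y by (auto simp: alg_def)
  note Ff = functor_hom[OF F f(1)] and Fg = functor_hom[OF F g(1)]
  note Tf = functor_hom[OF G Ff] and Tg = functor_hom[OF G Fg]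
  have "f \<cdot>\<^bsub>C\<^esub> (\<alpha> \<cdot>\<^bsub>C\<^esub> Amap G (Amap F g)) = \<beta> \<cdot>\<^bsub>C\<^esub> Amap G (Amap F (f \<cdot>\<^bsub>C\<^esub> g))"
    using C.comp_assoc[OF Tg a(1) f(1)] C.comp_assoc[OF Tg Tf a(2)] f(2)
      functor_comp[OF F g(1) f(1)] functor_comp[OF G Fg Ff] by simp
  also have "\<dots> = \<beta>"
    using g(3) o functor_id[OF F o(2)] functor_id[OF G functor_obj[OF F o(2)]]
      C.comp_id_right[OF a(2)] by simp
  finally have "f \<cdot>\<^bsub>C\<^esub> (\<alpha> \<cdot>\<^bsub>C\<^esub> Amap G (Amap F g)) = f \<cdot>\<^bsub>C\<^esub> (g \<cdot>\<^bsub>C\<^esub> \<beta>)"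
    using C.comp_assoc[OF a(2) g(1) f(1)] g(3) C.comp_id_left[OF a(2)] by simp
  then have "g \<cdot>\<^bsub>C\<^esub> \<beta> = \<alpha> \<cdot>\<^bsub>C\<^esub> Amap G (Amap F g)"
    using C.iso_cancel_left[OF fi f(1) C.comp_hom[OF Tg a(1)] C.comp_hom[OF a(2) g(1)]] by simp
  then have n: "((y, \<beta>), g, (x, \<alpha>)) \<in> hom EM (y, \<beta>) (x, \<alpha>)"
    using X Y g by (simp add: EM_hom alg_hom_def)
  have m: "((x, \<alpha>), f, (y, \<beta>)) \<in> hom EM (x, \<alpha>) (y, \<beta>)"
    using X Y f by (simp add: EM_hom alg_hom_def)
  have "iso EM ((x, \<alpha>), f, (y, \<beta>))"
    using g by (intro EM.isoI[OF m n]) (simp_all add: EM_Comp EM_Id)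
  then show "isomorphic EM (x, \<alpha>) (y, \<beta>)" using m unfolding isomorphic_def by blast
qed

text \<open>
  Monadicity without the Eilenberg-Moore category: arrows of \<open>D\<close> are the algebra
  morphisms between the algebras \<open>G y\<close>, and every algebra is isomorphic to one of these. Monadicity
  enters and leaves the later arguments in this form.
\<close>

lemma monadic_iff:
  "monadic_adjunction C D F G \<eta> \<epsilon> \<longleftrightarrow>
    (\<forall>y \<in> Obj D. \<forall>z \<in> Obj D. \<forall>h.
       alg_hom (Omap G y) (Amap G (\<epsilon> y)) (Omap G z) (Amap G (\<epsilon> z)) h \<longrightarrow>
       (\<exists>!m. m \<in> hom D y z \<and> Amap G m = h)) \<and>
    (\<forall>x \<alpha>. alg x \<alpha> \<longrightarrow>
       (\<exists>y \<in> Obj D. \<exists>f. alg_hom (Omap G y) (Amap G (\<epsilon> y)) x \<alpha> f \<and> iso C f))"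
    (is "_ \<longleftrightarrow> ?ff \<and> ?es")
proof -
  have "monadic_adjunction C D F G \<eta> \<epsilon> \<longleftrightarrow> is_equivalence D EM K"
    using adj by (simp add: monadic_adjunction_def)
  also have "\<dots> \<longleftrightarrow> fully_faithful D EM K \<and> essentially_surjective D EM K"
    using equivalence_imp_ff_es equivalence_if_ff_es[OF K_functor] by blast
  also have "essentially_surjective D EM K \<longleftrightarrow> ?es"
  proof -
    have "essentially_surjective D EM K \<longleftrightarrow> (\<forall>x \<alpha>. alg x \<alpha> \<longrightarrow>
        (\<exists>y \<in> Obj D. isomorphic EM (Omap G y, Amap G (\<epsilon> y)) (x, \<alpha>)))"
      by (simp add: essentially_surjective_def Ball_def split_paired_All EM_Obj K_Omap)
    then show ?thesis using EM_isomorphic_iff[OF alg_free] by blast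
  qed
  also have "fully_faithful D EM K \<longleftrightarrow> ?ff"
  proof -
    have "(m \<in> hom D y z \<and> Amap K m = (Omap K y, h, Omap K z)) \<longleftrightarrow> (m \<in> hom D y z \<and> Amap G m = h)"
      for y z m h using K_Amap by auto
    moreover have "(\<forall>h \<in> hom EM (Omap K y) (Omap K z). P h) \<longleftrightarrow>
        (\<forall>h. alg_hom (Omap G y) (Amap G (\<epsilon> y)) (Omap G z) (Amap G (\<epsilon> z)) h \<longrightarrow> P (Omap K y, h, Omap K z))"
      if "y \<in> Obj D" "z \<in> Obj D" for y z P
      using alg_free[OF that(1)] alg_free[OF that(2)] by (auto simp: K_Omap EM_hom)
    ultimately show ?thesis by (simp add: fully_faithful_def)
  qed
  finally show ?thesis by blast
qed

end

locale monadic_pair = adjoint_pair +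
  assumes monadic: "monadic_adjunction C D F G \<eta> \<epsilon>"
begin

lemma ex1_alg_hom_lift:
  assumes "y \<in> Obj D" "z \<in> Obj D"
    "alg_hom (Omap G y) (Amap G (\<epsilon> y)) (Omap G z) (Amap G (\<epsilon> z)) h"
  shows "\<exists>!m. m \<in> hom D y z \<and> Amap G m = h"
  using monadic assms unfolding monadic_iff by blast

lemma ex_alg_iso:
  assumes "alg x \<alpha>"
  obtains y f where "y \<in> Obj D" "alg_hom (Omap G y) (Amap G (\<epsilon> y)) x \<alpha> f" "iso C f"
  using monadic assms unfolding monadic_iff by blast

lemma right_adjoint_faithful:
  assumes m: "m \<in> hom D y z" "m' \<in> hom D y z" "Amap G m = Amap G m'"
  shows "m = m'"
  using ex1_alg_hom_lift[OF D.hom_obj1[OF m(1)] D.hom_obj2[OF m(1)] alg_hom_free[OF m(1)]] m by auto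

text \<open>
  The inverse of \<open>G m\<close> is an algebra morphism, hence of the form \<open>G n\<close>; by faithfulness \<open>n\<close> is
  inverse to \<open>m\<close>.
\<close>

lemma right_adjoint_reflects_iso:
  assumes m: "m \<in> hom D y z" and i: "iso C (Amap G m)"
  shows "iso D m"
proof -
  note o = D.hom_obj1[OF m] D.hom_obj2[OF m]
  note Gm = functor_hom[OF G m]
  obtain g where g: "g \<in> hom C (Omap G z) (Omap G y)" "g \<cdot>\<^bsub>C\<^esub> Amap G m = Id C (Omap G y)"
      "Amap G m \<cdot>\<^bsub>C\<^esub> g = Id C (Omap G z)" using C.isoE[OF i Gm] .
  note ey = functor_hom[OF G counit_hom[OF o(1)]] and ez = functor_hom[OF G counit_hom[OF o(2)]]
    and Tm = functor_hom[OF G functor_hom[OF F Gm]] and Tg = functor_hom[OF G functor_hom[OF F g(1)]]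
  let ?Tg = "Amap G (Amap F g)" and ?Tm = "Amap G (Amap F (Amap G m))"
  have "?Tm \<cdot>\<^bsub>C\<^esub> ?Tg = Id C (Omap G (Omap F (Omap G z)))"
    using functor_comp[OF G functor_hom[OF F g(1)] functor_hom[OF F Gm]] functor_comp[OF F g(1) Gm] g(3)
      functor_id[OF F functor_obj[OF G o(2)]] functor_id[OF G functor_obj[OF F functor_obj[OF G o(2)]]]
    by simp
  then have "Amap G m \<cdot>\<^bsub>C\<^esub> (Amap G (\<epsilon> y) \<cdot>\<^bsub>C\<^esub> ?Tg) = Amap G (\<epsilon> z)"
    using alg_hom_free[OF m] C.comp_assoc[OF Tg ey Gm] C.comp_assoc[OF Tg Tm ez] C.comp_id_right[OF ez]
    by (simp add: alg_hom_def)
  moreover have "Amap G m \<cdot>\<^bsub>C\<^esub> (g \<cdot>\<^bsub>C\<^esub> Amap G (\<epsilon> z)) = Amap G (\<epsilon> z)"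
    using C.comp_assoc[OF ez g(1) Gm] g(3) C.comp_id_left[OF ez] by simp
  ultimately have "alg_hom (Omap G z) (Amap G (\<epsilon> z)) (Omap G y) (Amap G (\<epsilon> y)) g"
    using C.iso_cancel_left[OF i Gm C.comp_hom[OF Tg ey] C.comp_hom[OF ez g(1)]] g(1)
    by (simp add: alg_hom_def)
  then obtain n where n: "n \<in> hom D z y" "Amap G n = g" using ex1_alg_hom_lift[OF o(2,1)] by blast
  have "n \<cdot>\<^bsub>D\<^esub> m = Id D y"
    using functor_comp[OF G m n(1)] functor_id[OF G o(1)] g(2) n(2)
    by (intro right_adjoint_faithful[OF D.comp_hom[OF m n(1)] D.id_hom[OF o(1)]]) simp
  moreover have "m \<cdot>\<^bsub>D\<^esub> n = Id D z"
    using functor_comp[OF G n(1) m] functor_id[OF G o(2)] g(3) n(2)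
    by (intro right_adjoint_faithful[OF D.comp_hom[OF n(1) m] D.id_hom[OF o(2)]]) simp
  ultimately show ?thesis using D.isoI[OF m n(1)] by simp
qed

end

section \<open>Left adjoint sections\<close>

text \<open>
  A left adjoint \<open>J\<close> of \<open>V\<close> whose unit is an identity, given by its universal property. It makes
  \<open>B\<close> a full coreflective subcategory of \<open>E\<close>. In this form the property is immediate for the
  op-Grothendieck construction and passes to slices by a short argument; the action of \<open>J\<close> on arrows
  (the functor \<open>S\<close>) and the counit \<open>\<kappa>\<close> are derived from it.
\<close>

locale left_adjoint_section =
  fixes E :: "('o, 'm) cat" and B :: "('p, 'n) cat"
    and V :: "('o, 'm, 'p, 'n) func" and J :: "'p \<Rightarrow> 'o"
  assumes V: "is_functor E B V"
    and section_obj: "c \<in> Obj B \<Longrightarrow> J c \<in> Obj E"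
    and section_over: "c \<in> Obj B \<Longrightarrow> Omap V (J c) = c"
    and ex1_lift: "\<lbrakk>c \<in> Obj B; e \<in> Obj E; f \<in> hom B c (Omap V e)\<rbrakk>
      \<Longrightarrow> \<exists>!m. m \<in> hom E (J c) e \<and> Amap V m = f"
begin

sublocale E: category E using functor_dom[OF V] .
sublocale B: category B using functor_cod[OF V] .

definition lift :: "'p \<Rightarrow> 'o \<Rightarrow> 'n \<Rightarrow> 'm" where
  "lift c e f = (THE m. m \<in> hom E (J c) e \<and> Amap V m = f)"

lemma
  assumes "e \<in> Obj E" "f \<in> hom B c (Omap V e)"
  shows lift_hom: "lift c e f \<in> hom E (J c) e" and lift_over: "Amap V (lift c e f) = f"
  using theI'[OF ex1_lift[OF B.hom_obj1[OF assms(2)] assms]] unfolding lift_def by blast+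

lemma eq_if_same_image:
  assumes c: "c \<in> Obj B" and m: "m \<in> hom E (J c) e" and m': "m' \<in> hom E (J c) e"
    and eq: "Amap V m = Amap V m'"
  shows "m = m'"
proof -
  have "Amap V m' \<in> hom B c (Omap V e)" using functor_hom[OF V m'] section_over[OF c] by simp
  from ex1_lift[OF c E.hom_obj2[OF m'] this] m m' eq show ?thesis by metis
qed

definition S :: "('p, 'n, 'o, 'm) func" where
  "S = \<lparr>Omap = J, Amap = (\<lambda>f. lift (Dom B f) (J (Cod B f)) f)\<rparr>"

lemma S_Omap [simp]: "Omap S = J"
  by (simp add: S_def)

lemma S_hom: "f \<in> hom B c d \<Longrightarrow> Amap S f \<in> hom E (J c) (J d)"
  and S_over: "f \<in> hom B c d \<Longrightarrow> Amap V (Amap S f) = f"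
  using lift_hom[of "J d" f c] lift_over[of "J d" f c] section_obj[of d] section_over[of d] B.hom_obj2[of f c d]
  by (simp_all add: S_def hom_dom hom_cod)

lemma S_eq:
  assumes c: "c \<in> Obj B" and d: "d \<in> Obj B" and m: "m \<in> hom E (J c) (J d)"
  shows "Amap S (Amap V m) = m"
proof -
  have Vm: "Amap V m \<in> hom B c d"
    using functor_hom[OF V m] section_over[OF c] section_over[OF d] by simp
  show ?thesis using eq_if_same_image[OF c S_hom[OF Vm] m S_over[OF Vm]] .
qed

lemma S_functor: "is_functor B E S"
proof (rule is_functorI[OF B.category_axioms E.category_axioms], goal_cases)
  case (3 a)
  show ?case
    using S_eq[OF 3 3 E.id_hom[OF section_obj[OF 3]]] functor_id[OF V section_obj[OF 3]] section_over[OF 3] by simp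
next
  case (4 a b c f g)
  show ?case
    using S_eq[OF B.hom_obj1[OF 4(1)] B.hom_obj2[OF 4(2)] E.comp_hom[OF S_hom[OF 4(1)] S_hom[OF 4(2)]]]
      functor_comp[OF V S_hom[OF 4(1)] S_hom[OF 4(2)]] by (simp add: S_over[OF 4(1)] S_over[OF 4(2)])
qed (auto simp: section_obj S_hom)

definition \<kappa> :: "'o \<Rightarrow> 'm" where
  "\<kappa> e = lift (Omap V e) e (Id B (Omap V e))"

lemma
  assumes e: "e \<in> Obj E"
  shows \<kappa>_hom: "\<kappa> e \<in> hom E (J (Omap V e)) e" and \<kappa>_over: "Amap V (\<kappa> e) = Id B (Omap V e)"
  unfolding \<kappa>_def using lift_hom[OF e] lift_over[OF e] B.id_hom[OF functor_obj[OF V e]] by blast+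

lemma \<kappa>_nat:
  assumes m: "m \<in> hom E e e'"
  shows "\<kappa> e' \<cdot>\<^bsub>E\<^esub> Amap S (Amap V m) = m \<cdot>\<^bsub>E\<^esub> \<kappa> e"
proof -
  note o = E.hom_obj1[OF m] E.hom_obj2[OF m] and Vm = functor_hom[OF V m]
  show ?thesis
    by (rule eq_if_same_image[OF functor_obj[OF V o(1)] E.comp_hom[OF S_hom[OF Vm] \<kappa>_hom[OF o(2)]]
            E.comp_hom[OF \<kappa>_hom[OF o(1)] m]])
      (simp add: functor_comp[OF V S_hom[OF Vm] \<kappa>_hom[OF o(2)]] functor_comp[OF V \<kappa>_hom[OF o(1)] m]
        S_over[OF Vm] \<kappa>_over[OF o(1)] \<kappa>_over[OF o(2)] B.comp_id_left[OF Vm] B.comp_id_right[OF Vm])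
qed

lemma \<kappa>_section: "c \<in> Obj B \<Longrightarrow> \<kappa> (J c) = Id E (J c)"
  using eq_if_same_image[of c "\<kappa> (J c)" "J c" "Id E (J c)"] \<kappa>_hom[OF section_obj] \<kappa>_over[OF section_obj]
    E.id_hom[OF section_obj] functor_id[OF V section_obj] by (simp add: section_over)

text \<open>
  The objects \<open>e\<close> with \<open>\<kappa> e\<close> invertible are those in the coreflective subcategory, up to
  isomorphism; \<open>V\<close> is fully faithful on arrows that start there.
\<close>

lemma faithful_on_coreflective:
  assumes i: "iso E (\<kappa> e)" and m: "m \<in> hom E e e'" "m' \<in> hom E e e'" and eq: "Amap V m = Amap V m'"
  shows "m = m'"
proof -
  note e = E.hom_obj1[OF m(1)]
  have "m \<cdot>\<^bsub>E\<^esub> \<kappa> e = m' \<cdot>\<^bsub>E\<^esub> \<kappa> e" using \<kappa>_nat[OF m(1)] \<kappa>_nat[OF m(2)] eq by simp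
  then show ?thesis using E.iso_cancel_right[OF i \<kappa>_hom[OF e] m] by simp
qed

lemma full_on_coreflective:
  assumes i: "iso E (\<kappa> e)" and e: "e \<in> Obj E" "e' \<in> Obj E" and h: "h \<in> hom B (Omap V e) (Omap V e')"
  obtains m where "m \<in> hom E e e'" "Amap V m = h"
proof -
  obtain j where j: "j \<in> hom E e (J (Omap V e))" "\<kappa> e \<cdot>\<^bsub>E\<^esub> j = Id E e" using E.isoE[OF i \<kappa>_hom[OF e(1)]] .
  have Vj: "Amap V j \<in> hom B (Omap V e) (Omap V e)"
    using functor_hom[OF V j(1)] section_over[OF functor_obj[OF V e(1)]] by simp
  have "Amap V j = Id B (Omap V e)"
    using functor_comp[OF V j(1) \<kappa>_hom[OF e(1)]] \<kappa>_over[OF e(1)] B.comp_id_left[OF Vj] j(2)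
      functor_id[OF V e(1)] by simp
  then have "Amap V (lift (Omap V e) e' h \<cdot>\<^bsub>E\<^esub> j) = h"
    using functor_comp[OF V j(1) lift_hom[OF e(2) h]] lift_over[OF e(2) h] B.comp_id_right[OF h] by simp
  then show thesis using that[OF E.comp_hom[OF j(1) lift_hom[OF e(2) h]]] by simp
qed

end


section \<open>Restricting a monadic adjunction along left adjoint sections\<close>

text \<open>
  The functor \<open>F\<close> commutes strictly with the coreflections \<open>V\<close>, \<open>W\<close> and, on objects, with their
  sections \<open>J\<close>, \<open>I\<close>. It then commutes with the sections on arrows and with the counits \<open>\<kappa>\<close> as well,
  because an arrow out of an object \<open>I d\<close> is determined by its image under \<open>W\<close>.
\<close>

locale coreflected_adjunction =
  adjoint_pair C D F G \<eta> \<epsilon> +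
  CS: left_adjoint_section C C\<^sub>0 V J +
  DS: left_adjoint_section D D\<^sub>0 W I
  for C :: "('o, 'm) cat" and D :: "('p, 'n) cat" and F G \<eta> \<epsilon>
    and C\<^sub>0 :: "('o0, 'm0) cat" and V J and D\<^sub>0 :: "('p0, 'n0) cat" and W I +
  fixes F\<^sub>0 :: "('o0, 'm0, 'p0, 'n0) func"
  assumes F\<^sub>0: "is_functor C\<^sub>0 D\<^sub>0 F\<^sub>0"
    and over_obj: "x \<in> Obj C \<Longrightarrow> Omap W (Omap F x) = Omap F\<^sub>0 (Omap V x)"
    and over_arr: "f \<in> Arr C \<Longrightarrow> Amap W (Amap F f) = Amap F\<^sub>0 (Amap V f)"
    and sections: "c \<in> Obj C\<^sub>0 \<Longrightarrow> Omap F (J c) = I (Omap F\<^sub>0 c)"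
begin

definition G\<^sub>0 :: "('p0, 'n0, 'o0, 'm0) func" where
  "G\<^sub>0 = V \<circ>\<^sub>F (G \<circ>\<^sub>F DS.S)"

definition \<eta>\<^sub>0 :: "'o0 \<Rightarrow> 'm0" where
  "\<eta>\<^sub>0 c = Amap V (\<eta> (J c))"

definition \<epsilon>\<^sub>0 :: "'p0 \<Rightarrow> 'n0" where
  "\<epsilon>\<^sub>0 d = Amap W (\<epsilon> (I d))"

lemma G\<^sub>0_Omap: "Omap G\<^sub>0 d = Omap V (Omap G (I d))"
  and G\<^sub>0_Amap: "Amap G\<^sub>0 f = Amap V (Amap G (Amap DS.S f))"
  by (simp_all add: G\<^sub>0_def comp_func_def)

lemma G\<^sub>0_functor: "is_functor D\<^sub>0 C\<^sub>0 G\<^sub>0"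
  unfolding G\<^sub>0_def by (intro is_functor_comp[OF is_functor_comp[OF DS.S_functor G] CS.V])

lemma F_hom_section:
  assumes "m \<in> hom C (J c) x" "c \<in> Obj C\<^sub>0"
  shows "Amap F m \<in> hom D (I (Omap F\<^sub>0 c)) (Omap F x)"
  using functor_hom[OF F assms(1)] sections[OF assms(2)] by simp

lemma F_S:
  assumes f: "f \<in> hom C\<^sub>0 c d"
  shows "Amap F (Amap CS.S f) = Amap DS.S (Amap F\<^sub>0 f)"
proof -
  note c = CS.B.hom_obj1[OF f] and d = CS.B.hom_obj2[OF f]
  have h: "Amap F (Amap CS.S f) \<in> hom D (I (Omap F\<^sub>0 c)) (I (Omap F\<^sub>0 d))"
    using F_hom_section[OF CS.S_hom[OF f] c] sections[OF d] by simp
  show ?thesis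
    using DS.S_eq[OF functor_obj[OF F\<^sub>0 c] functor_obj[OF F\<^sub>0 d] h]
      over_arr[OF hom_arr[OF CS.S_hom[OF f]]] CS.S_over[OF f] by simp
qed

lemma F_\<kappa>:
  assumes x: "x \<in> Obj C"
  shows "Amap F (CS.\<kappa> x) = DS.\<kappa> (Omap F x)"
proof (rule DS.eq_if_same_image)
  note Vx = functor_obj[OF CS.V x] and Fx = functor_obj[OF F x]
  show "Omap F\<^sub>0 (Omap V x) \<in> Obj D\<^sub>0" using functor_obj[OF F\<^sub>0 Vx] .
  show "Amap F (CS.\<kappa> x) \<in> hom D (I (Omap F\<^sub>0 (Omap V x))) (Omap F x)"
    using F_hom_section[OF CS.\<kappa>_hom[OF x] Vx] .
  show "DS.\<kappa> (Omap F x) \<in> hom D (I (Omap F\<^sub>0 (Omap V x))) (Omap F x)"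
    using DS.\<kappa>_hom[OF Fx] over_obj[OF x] by simp
  show "Amap W (Amap F (CS.\<kappa> x)) = Amap W (DS.\<kappa> (Omap F x))"
    using over_arr[OF hom_arr[OF CS.\<kappa>_hom[OF x]]] CS.\<kappa>_over[OF x] DS.\<kappa>_over[OF Fx] over_obj[OF x]
      functor_id[OF F\<^sub>0 Vx] by simp
qed

lemma T\<kappa>_hom:
  assumes x: "x \<in> Obj C"
  shows "Amap G (Amap F (CS.\<kappa> x)) \<in> hom C (Omap G (I (Omap F\<^sub>0 (Omap V x)))) (Omap G (Omap F x))"
  using functor_hom[OF G F_hom_section[OF CS.\<kappa>_hom[OF x] functor_obj[OF CS.V x]]] .

lemma S_W_counit:
  assumes y: "y \<in> Obj D"
  shows "DS.\<kappa> y \<cdot>\<^bsub>D\<^esub> Amap DS.S (Amap W (\<epsilon> y)) = \<epsilon> y \<cdot>\<^bsub>D\<^esub> Amap F (CS.\<kappa> (Omap G y))"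
  using DS.\<kappa>_nat[OF counit_hom[OF y]] F_\<kappa>[OF functor_obj[OF G y]] by simp

lemma G_I_obj: "d \<in> Obj D\<^sub>0 \<Longrightarrow> Omap G (I d) \<in> Obj C"
  using functor_obj[OF G DS.section_obj] .

text \<open>
  If \<open>\<alpha>\<close> is an action of the monad \<open>G F\<close> on \<open>x\<close>, this is the corresponding action of \<open>G\<^sub>0 F\<^sub>0\<close> on
  \<open>V x\<close>: the functor \<open>G\<^sub>0 F\<^sub>0\<close> sends \<open>V x\<close> to \<open>V (G (F (J (V x))))\<close>, and \<open>\<kappa> x\<close> mediates between
  \<open>J (V x)\<close> and \<open>x\<close>.
\<close>

definition restrict :: "'o \<Rightarrow> 'm \<Rightarrow> 'm0" where
  "restrict x \<alpha> = Amap V (\<alpha> \<cdot>\<^bsub>C\<^esub> Amap G (Amap F (CS.\<kappa> x)))"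

text \<open>
  The algebra that the comparison functor of the restricted adjunction assigns to \<open>d\<close> is the
  restriction of the one that the big comparison functor assigns to \<open>I d\<close>.
\<close>

lemma G\<^sub>0_counit:
  assumes d: "d \<in> Obj D\<^sub>0"
  shows "Amap G\<^sub>0 (\<epsilon>\<^sub>0 d) = restrict (Omap G (I d)) (Amap G (\<epsilon> (I d)))"
proof -
  note Id = DS.section_obj[OF d] and x = G_I_obj[OF d]
  note e = counit_hom[OF Id]
  have We: "Amap W (\<epsilon> (I d)) \<in> hom D\<^sub>0 (Omap W (Omap F (Omap G (I d)))) d"
    using functor_hom[OF DS.V e] DS.section_over[OF d] by simp
  have "Amap DS.S (\<epsilon>\<^sub>0 d) = \<epsilon> (I d) \<cdot>\<^bsub>D\<^esub> Amap F (CS.\<kappa> (Omap G (I d)))"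
    using S_W_counit[OF Id] DS.\<kappa>_section[OF d] D.comp_id_left[OF DS.S_hom[OF We]] by (simp add: \<epsilon>\<^sub>0_def)
  then show ?thesis
    using functor_comp[OF G functor_hom[OF F CS.\<kappa>_hom[OF x]] e] by (simp add: G\<^sub>0_Amap restrict_def)
qed

lemma unit_\<kappa>:
  assumes x: "x \<in> Obj C"
  shows "Amap G (Amap F (CS.\<kappa> x)) \<cdot>\<^bsub>C\<^esub> \<eta> (J (Omap V x)) = \<eta> x \<cdot>\<^bsub>C\<^esub> CS.\<kappa> x"
  using unit_nat[OF CS.\<kappa>_hom[OF x]] by simp

lemma unit_section_hom:
  assumes c: "c \<in> Obj C\<^sub>0"
  shows "\<eta> (J c) \<in> hom C (J c) (Omap G (I (Omap F\<^sub>0 c)))"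
  using unit_hom[OF CS.section_obj[OF c]] sections[OF c] by simp

lemma \<eta>\<^sub>0_hom:
  assumes c: "c \<in> Obj C\<^sub>0"
  shows "\<eta>\<^sub>0 c \<in> hom C\<^sub>0 c (Omap G\<^sub>0 (Omap F\<^sub>0 c))"
  using functor_hom[OF CS.V unit_section_hom[OF c]] CS.section_over[OF c] by (simp add: \<eta>\<^sub>0_def G\<^sub>0_Omap)

lemma \<epsilon>\<^sub>0_hom:
  assumes d: "d \<in> Obj D\<^sub>0"
  shows "\<epsilon>\<^sub>0 d \<in> hom D\<^sub>0 (Omap F\<^sub>0 (Omap G\<^sub>0 d)) d"
  using functor_hom[OF DS.V counit_hom[OF DS.section_obj[OF d]]] over_obj[OF G_I_obj[OF d]] DS.section_over[OF d]
  by (simp add: \<epsilon>\<^sub>0_def G\<^sub>0_Omap)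

text \<open>
  This is the image under \<open>V\<close> of the triangle identity of \<open>F \<stileturn> G\<close> at \<open>I d\<close>, once
  naturality of \<open>\<eta>\<close> has moved \<open>\<kappa>\<close> past the unit, where \<open>V\<close> turns it into an identity.
\<close>

lemma restricted_triangle:
  assumes d: "d \<in> Obj D\<^sub>0"
  shows "Amap G\<^sub>0 (\<epsilon>\<^sub>0 d) \<cdot>\<^bsub>C\<^sub>0\<^esub> \<eta>\<^sub>0 (Omap G\<^sub>0 d) = Id C\<^sub>0 (Omap G\<^sub>0 d)"
proof -
  let ?x = "Omap G (I d)"
  note Id = DS.section_obj[OF d] and x = G_I_obj[OF d]
  note Vx = functor_obj[OF CS.V x]
  note e = functor_hom[OF G counit_hom[OF Id]] and Tk = functor_hom[OF G functor_hom[OF F CS.\<kappa>_hom[OF x]]]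
  note u = unit_hom[OF CS.section_obj[OF Vx]]
  have "(Amap G (\<epsilon> (I d)) \<cdot>\<^bsub>C\<^esub> Amap G (Amap F (CS.\<kappa> ?x))) \<cdot>\<^bsub>C\<^esub> \<eta> (J (Omap V ?x))
      = (Amap G (\<epsilon> (I d)) \<cdot>\<^bsub>C\<^esub> \<eta> ?x) \<cdot>\<^bsub>C\<^esub> CS.\<kappa> ?x"
    using C.comp_assoc[OF u Tk e] unit_\<kappa>[OF x] C.comp_assoc[OF CS.\<kappa>_hom[OF x] unit_hom[OF x] e] by simp
  also have "\<dots> = CS.\<kappa> ?x"
    using triangle_right[OF Id] C.comp_id_left[OF CS.\<kappa>_hom[OF x]] by simp
  finally show ?thesis
    using functor_comp[OF CS.V u C.comp_hom[OF Tk e]] CS.\<kappa>_over[OF x]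
    by (simp add: G\<^sub>0_counit[OF d] restrict_def \<eta>\<^sub>0_def G\<^sub>0_Omap)
qed

lemma restricted_adjunction: "adjunction C\<^sub>0 D\<^sub>0 F\<^sub>0 G\<^sub>0 \<eta>\<^sub>0 \<epsilon>\<^sub>0"
  unfolding adjunction_def
proof (intro conjI ballI F\<^sub>0 G\<^sub>0_functor restricted_triangle)
  show "nat_trans C\<^sub>0 C\<^sub>0 id_func (G\<^sub>0 \<circ>\<^sub>F F\<^sub>0) \<eta>\<^sub>0"
  proof (rule nat_transI[OF is_functor_id[OF CS.B.category_axioms] is_functor_comp[OF F\<^sub>0 G\<^sub>0_functor]], goal_cases)
    case (1 a) then show ?case by (simp add: id_func_def comp_func_def \<eta>\<^sub>0_hom)
  next
    case (2 a b f)
    note o = CS.B.hom_obj1[OF 2] CS.B.hom_obj2[OF 2]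
    have "Amap V (\<eta> (J b) \<cdot>\<^bsub>C\<^esub> Amap CS.S f) = Amap V (Amap G (Amap F (Amap CS.S f)) \<cdot>\<^bsub>C\<^esub> \<eta> (J a))"
      using unit_nat[OF CS.S_hom[OF 2]] by simp
    then have "\<eta>\<^sub>0 b \<cdot>\<^bsub>C\<^sub>0\<^esub> f = Amap G\<^sub>0 (Amap F\<^sub>0 f) \<cdot>\<^bsub>C\<^sub>0\<^esub> \<eta>\<^sub>0 a"
      using functor_comp[OF CS.V CS.S_hom[OF 2] unit_hom[OF CS.section_obj[OF o(2)]]]
        functor_comp[OF CS.V unit_hom[OF CS.section_obj[OF o(1)]] functor_hom[OF G functor_hom[OF F CS.S_hom[OF 2]]]]
        CS.S_over[OF 2] F_S[OF 2]
      by (simp add: \<eta>\<^sub>0_def G\<^sub>0_Amap)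
    then show ?case by (simp add: id_func_def comp_func_def)
  qed
  show "nat_trans D\<^sub>0 D\<^sub>0 (F\<^sub>0 \<circ>\<^sub>F G\<^sub>0) id_func \<epsilon>\<^sub>0"
  proof (rule nat_transI[OF is_functor_comp[OF G\<^sub>0_functor F\<^sub>0] is_functor_id[OF DS.B.category_axioms]], goal_cases)
    case (1 a) then show ?case by (simp add: id_func_def comp_func_def \<epsilon>\<^sub>0_hom)
  next
    case (2 a b f)
    note o = DS.B.hom_obj1[OF 2] DS.B.hom_obj2[OF 2]
    note GS = functor_hom[OF G DS.S_hom[OF 2]]
    have "Amap W (\<epsilon> (I b) \<cdot>\<^bsub>D\<^esub> Amap F (Amap G (Amap DS.S f))) = Amap W (Amap DS.S f \<cdot>\<^bsub>D\<^esub> \<epsilon> (I a))"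
      using counit_nat[OF DS.S_hom[OF 2]] by simp
    then have "\<epsilon>\<^sub>0 b \<cdot>\<^bsub>D\<^sub>0\<^esub> Amap F\<^sub>0 (Amap G\<^sub>0 f) = f \<cdot>\<^bsub>D\<^sub>0\<^esub> \<epsilon>\<^sub>0 a"
      using functor_comp[OF DS.V functor_hom[OF F GS] counit_hom[OF DS.section_obj[OF o(2)]]]
        functor_comp[OF DS.V counit_hom[OF DS.section_obj[OF o(1)]] DS.S_hom[OF 2]]
        DS.S_over[OF 2] over_arr[OF hom_arr[OF GS]]
      by (simp add: \<epsilon>\<^sub>0_def G\<^sub>0_Amap)
    then show ?case by (simp add: id_func_def comp_func_def)
  qed
next
  fix c assume c: "c \<in> Obj C\<^sub>0"
  note Jc = CS.section_obj[OF c]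
  note u = unit_hom[OF Jc] and e = counit_hom[OF functor_obj[OF F Jc]]
  show "\<epsilon>\<^sub>0 (Omap F\<^sub>0 c) \<cdot>\<^bsub>D\<^sub>0\<^esub> Amap F\<^sub>0 (\<eta>\<^sub>0 c) = Id D\<^sub>0 (Omap F\<^sub>0 c)"
    using functor_comp[OF DS.V functor_hom[OF F u] e] triangle_left[OF Jc]
      functor_id[OF DS.V functor_obj[OF F Jc]] over_obj[OF Jc] over_arr[OF hom_arr[OF u]]
      CS.section_over[OF c] sections[OF c]
    by (simp add: \<epsilon>\<^sub>0_def \<eta>\<^sub>0_def)
qed

sublocale R: adjoint_pair C\<^sub>0 D\<^sub>0 F\<^sub>0 G\<^sub>0 \<eta>\<^sub>0 \<epsilon>\<^sub>0
  by unfold_locales (rule restricted_adjunction)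

text \<open>
  Both \<open>V G\<close> and \<open>G\<^sub>0 W\<close> are right adjoint to \<open>F J = I F\<^sub>0\<close>, and \<open>V (G (\<kappa> y))\<close> is the comparison
  between them. Its inverse is the transpose, with respect to \<open>F\<^sub>0 \<stileturn> G\<^sub>0\<close>, of
  \<open>W (\<epsilon> y) : F\<^sub>0 (V (G y)) = W (F (G y)) \<rightarrow> W y\<close>.
\<close>

lemma iso_V_G_\<kappa>:
  assumes y: "y \<in> Obj D"
  shows "iso C\<^sub>0 (Amap V (Amap G (DS.\<kappa> y)))"
proof -
  let ?d = "Omap W y" and ?x = "Omap G y"
  let ?c = "Omap V ?x"
  let ?Se = "Amap DS.S (Amap W (\<epsilon> y))"
  let ?k = "Amap V (Amap G (DS.\<kappa> y))"
  have d: "?d \<in> Obj D\<^sub>0" using functor_obj[OF DS.V y] .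
  have x: "?x \<in> Obj C" using functor_obj[OF G y] .
  have c: "?c \<in> Obj C\<^sub>0" using functor_obj[OF CS.V x] .
  note e = counit_hom[OF y]
  have We: "Amap W (\<epsilon> y) \<in> hom D\<^sub>0 (Omap F\<^sub>0 ?c) ?d"
    using functor_hom[OF DS.V e] over_obj[OF x] by simp
  note Se = DS.S_hom[OF We]
  note GSe = functor_hom[OF G Se] and Gk = functor_hom[OF G DS.\<kappa>_hom[OF y]]
  note u = unit_section_hom[OF c]
  let ?n = "Amap V (Amap G ?Se \<cdot>\<^bsub>C\<^esub> \<eta> (J ?c))"
  have k: "?k \<in> hom C\<^sub>0 (Omap G\<^sub>0 ?d) ?c"
    using functor_hom[OF CS.V Gk] by (simp add: G\<^sub>0_Omap)
  have n: "?n \<in> hom C\<^sub>0 ?c (Omap G\<^sub>0 ?d)"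
    using functor_hom[OF CS.V C.comp_hom[OF u GSe]] CS.section_over[OF c] by (simp add: G\<^sub>0_Omap)
  have n_eq: "?n = Amap G\<^sub>0 (Amap W (\<epsilon> y)) \<cdot>\<^bsub>C\<^sub>0\<^esub> \<eta>\<^sub>0 ?c"
    using functor_comp[OF CS.V u GSe] by (simp add: G\<^sub>0_Amap \<eta>\<^sub>0_def)
  have "Amap G (DS.\<kappa> y) \<cdot>\<^bsub>C\<^esub> (Amap G ?Se \<cdot>\<^bsub>C\<^esub> \<eta> (J ?c))
      = Amap G (\<epsilon> y \<cdot>\<^bsub>D\<^esub> Amap F (CS.\<kappa> ?x)) \<cdot>\<^bsub>C\<^esub> \<eta> (J ?c)"
    using C.comp_assoc[OF u GSe Gk] functor_comp[OF G Se DS.\<kappa>_hom[OF y]] S_W_counit[OF y] by simp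
  also have "\<dots> = Amap G (\<epsilon> y) \<cdot>\<^bsub>C\<^esub> (\<eta> ?x \<cdot>\<^bsub>C\<^esub> CS.\<kappa> ?x)"
    using functor_comp[OF G F_hom_section[OF CS.\<kappa>_hom[OF x] c] e]
      C.comp_assoc[OF u T\<kappa>_hom[OF x] functor_hom[OF G e]] unit_\<kappa>[OF x] by simp
  also have "\<dots> = CS.\<kappa> ?x"
    using C.comp_assoc[OF CS.\<kappa>_hom[OF x] unit_hom[OF x] functor_hom[OF G e]] triangle_right[OF y]
      C.comp_id_left[OF CS.\<kappa>_hom[OF x]] by simp
  finally have kn: "?k \<cdot>\<^bsub>C\<^sub>0\<^esub> ?n = Id C\<^sub>0 ?c"
    using functor_comp[OF CS.V C.comp_hom[OF u GSe] Gk] CS.\<kappa>_over[OF x] by simp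
  have F\<^sub>0k: "Amap F\<^sub>0 ?k = Amap W (Amap F (Amap G (DS.\<kappa> y)))"
    using over_arr[OF hom_arr[OF Gk]] by simp
  note F\<^sub>0k_hom = functor_hom[OF F\<^sub>0 k]
  note Id = DS.section_obj[OF d]
  have "Amap W (\<epsilon> y) \<cdot>\<^bsub>D\<^sub>0\<^esub> Amap F\<^sub>0 ?k = Amap W (DS.\<kappa> y \<cdot>\<^bsub>D\<^esub> \<epsilon> (I ?d))"
    using functor_comp[OF DS.V functor_hom[OF F Gk] e] F\<^sub>0k counit_nat[OF DS.\<kappa>_hom[OF y]] by simp
  also have "\<dots> = \<epsilon>\<^sub>0 ?d"
    using functor_comp[OF DS.V counit_hom[OF Id] DS.\<kappa>_hom[OF y]] DS.\<kappa>_over[OF y]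
      DS.B.comp_id_left[OF \<epsilon>\<^sub>0_hom[OF d]] by (simp add: \<epsilon>\<^sub>0_def)
  finally have We_k: "Amap W (\<epsilon> y) \<cdot>\<^bsub>D\<^sub>0\<^esub> Amap F\<^sub>0 ?k = \<epsilon>\<^sub>0 ?d" .
  have "?n \<cdot>\<^bsub>C\<^sub>0\<^esub> ?k = Amap G\<^sub>0 (Amap W (\<epsilon> y)) \<cdot>\<^bsub>C\<^sub>0\<^esub> (\<eta>\<^sub>0 ?c \<cdot>\<^bsub>C\<^sub>0\<^esub> ?k)"
    using n_eq CS.B.comp_assoc[OF k \<eta>\<^sub>0_hom[OF c] functor_hom[OF G\<^sub>0_functor We]] by simp
  also have "\<dots> = Amap G\<^sub>0 (Amap W (\<epsilon> y) \<cdot>\<^bsub>D\<^sub>0\<^esub> Amap F\<^sub>0 ?k) \<cdot>\<^bsub>C\<^sub>0\<^esub> \<eta>\<^sub>0 (Omap G\<^sub>0 ?d)"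
    using R.unit_nat[OF k] functor_comp[OF G\<^sub>0_functor F\<^sub>0k_hom We]
      CS.B.comp_assoc[OF R.unit_hom[OF functor_obj[OF G\<^sub>0_functor d]]
        functor_hom[OF G\<^sub>0_functor F\<^sub>0k_hom] functor_hom[OF G\<^sub>0_functor We]] by simp
  also have "\<dots> = Id C\<^sub>0 (Omap G\<^sub>0 ?d)"
    using We_k restricted_triangle[OF d] by simp
  finally show ?thesis using CS.B.isoI[OF k n _ kn] by simp
qed

lemma restrict_section:
  assumes c: "c \<in> Obj C\<^sub>0" and a: "\<alpha> \<in> hom C (Omap G (Omap F (J c))) x"
  shows "restrict (J c) \<alpha> = Amap V \<alpha>"
  using CS.\<kappa>_section[OF c] functor_id[OF F CS.section_obj[OF c]]
    functor_id[OF G functor_obj[OF F CS.section_obj[OF c]]] C.comp_id_right[OF a]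
  by (simp add: restrict_def)

lemma
  assumes x: "x \<in> Obj C" and y: "y \<in> Obj C"
    and a: "\<alpha> \<in> hom C (Omap G (Omap F x)) x" and b: "\<beta> \<in> hom C (Omap G (Omap F y)) y"
    and h: "h \<in> hom C x y"
  shows restrict_left: "Amap V h \<cdot>\<^bsub>C\<^sub>0\<^esub> restrict x \<alpha> = Amap V ((h \<cdot>\<^bsub>C\<^esub> \<alpha>) \<cdot>\<^bsub>C\<^esub> Amap G (Amap F (CS.\<kappa> x)))"
    and restrict_right: "restrict y \<beta> \<cdot>\<^bsub>C\<^sub>0\<^esub> Amap G\<^sub>0 (Amap F\<^sub>0 (Amap V h))
      = Amap V ((\<beta> \<cdot>\<^bsub>C\<^esub> Amap G (Amap F h)) \<cdot>\<^bsub>C\<^esub> Amap G (Amap F (CS.\<kappa> x)))"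
proof -
  note kx = CS.\<kappa>_hom[OF x] and ky = CS.\<kappa>_hom[OF y]
  note Tkx = T\<kappa>_hom[OF x] and Tky = functor_hom[OF G functor_hom[OF F ky]]
  note Th = functor_hom[OF G functor_hom[OF F h]]
  show "Amap V h \<cdot>\<^bsub>C\<^sub>0\<^esub> restrict x \<alpha> = Amap V ((h \<cdot>\<^bsub>C\<^esub> \<alpha>) \<cdot>\<^bsub>C\<^esub> Amap G (Amap F (CS.\<kappa> x)))"
    using functor_comp[OF CS.V C.comp_hom[OF Tkx a] h] C.comp_assoc[OF Tkx a h] by (simp add: restrict_def)
  note Vh = functor_hom[OF CS.V h]
  note SVh = CS.S_hom[OF Vh]
  note TSVh = functor_hom[OF G functor_hom[OF F SVh]]
  have "Amap G (Amap F h) \<cdot>\<^bsub>C\<^esub> Amap G (Amap F (CS.\<kappa> x)) = Amap G (Amap F (h \<cdot>\<^bsub>C\<^esub> CS.\<kappa> x))"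
    using functor_comp[OF F kx h] functor_comp[OF G functor_hom[OF F kx] functor_hom[OF F h]] by simp
  also have "\<dots> = Amap G (Amap F (CS.\<kappa> y)) \<cdot>\<^bsub>C\<^esub> Amap G (Amap F (Amap CS.S (Amap V h)))"
    using CS.\<kappa>_nat[OF h] functor_comp[OF F SVh ky]
      functor_comp[OF G functor_hom[OF F SVh] functor_hom[OF F ky]] by simp
  finally have "(\<beta> \<cdot>\<^bsub>C\<^esub> Amap G (Amap F h)) \<cdot>\<^bsub>C\<^esub> Amap G (Amap F (CS.\<kappa> x))
      = (\<beta> \<cdot>\<^bsub>C\<^esub> Amap G (Amap F (CS.\<kappa> y))) \<cdot>\<^bsub>C\<^esub> Amap G (Amap F (Amap CS.S (Amap V h)))"
    using C.comp_assoc[OF Tkx _ b] C.comp_assoc[OF TSVh Tky b] Th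
      C.comp_assoc[OF functor_hom[OF G functor_hom[OF F kx]] Th b] by simp
  moreover have "Amap V (Amap G (Amap F (Amap CS.S (Amap V h)))) = Amap G\<^sub>0 (Amap F\<^sub>0 (Amap V h))"
    using F_S[OF Vh] by (simp add: G\<^sub>0_Amap)
  ultimately show "restrict y \<beta> \<cdot>\<^bsub>C\<^sub>0\<^esub> Amap G\<^sub>0 (Amap F\<^sub>0 (Amap V h))
      = Amap V ((\<beta> \<cdot>\<^bsub>C\<^esub> Amap G (Amap F h)) \<cdot>\<^bsub>C\<^esub> Amap G (Amap F (CS.\<kappa> x)))"
    using functor_comp[OF CS.V TSVh C.comp_hom[OF Tky b]] by (simp add: restrict_def)
qed

text \<open>
  The two sides of the equation for an algebra morphism \<open>h\<close>, precomposed with \<open>G (F (\<kappa> x))\<close>, are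
  sent by \<open>V\<close> to the two sides of the equation for \<open>V h\<close> between the restricted algebras.
\<close>

lemma alg_hom_restrict:
  assumes x: "x \<in> Obj C" and y: "y \<in> Obj C"
    and a: "\<alpha> \<in> hom C (Omap G (Omap F x)) x" and b: "\<beta> \<in> hom C (Omap G (Omap F y)) y"
    and h: "alg_hom x \<alpha> y \<beta> h"
  shows "R.alg_hom (Omap V x) (restrict x \<alpha>) (Omap V y) (restrict y \<beta>) (Amap V h)"
proof -
  have "h \<in> hom C x y" "h \<cdot>\<^bsub>C\<^esub> \<alpha> = \<beta> \<cdot>\<^bsub>C\<^esub> Amap G (Amap F h)" using h by (auto simp: alg_hom_def)
  with restrict_left[OF x y a b, of h] restrict_right[OF x y a b, of h] functor_hom[OF CS.V] show ?thesis
    by (simp add: R.alg_hom_def)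
qed

end

text \<open>
  The last assumption says that \<open>C\<^sub>0\<close> absorbs: an object \<open>x\<close> belongs to it as soon as \<open>F x\<close> maps to
  an object coming from \<open>D\<^sub>0\<close>.
\<close>

locale coreflected_monadic_adjunction = coreflected_adjunction +
  assumes monadic: "monadic_adjunction C D F G \<eta> \<epsilon>"
    and coreflective_if_over_section:
      "\<lbrakk>x \<in> Obj C; d \<in> Obj D\<^sub>0; f \<in> hom D (Omap F x) (I d)\<rbrakk> \<Longrightarrow> iso C (CS.\<kappa> x)"
begin

sublocale monadic_pair C D F G \<eta> \<epsilon>
  by unfold_locales (rule monadic)

lemma iso_\<kappa>_G_I: "d \<in> Obj D\<^sub>0 \<Longrightarrow> iso C (CS.\<kappa> (Omap G (I d)))"
  using coreflective_if_over_section[OF G_I_obj _ counit_hom[OF DS.section_obj]] .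

text \<open>
  Naturality of \<open>\<kappa>\<close> at the arrow \<open>G (\<kappa> y)\<close>, together with the invertibility of \<open>V (G (\<kappa> y))\<close>,
  shows that \<open>G (\<kappa> y)\<close> is invertible, and \<open>G\<close> reflects isomorphisms.
\<close>

lemma iso_\<kappa>_if_iso_\<kappa>_G:
  assumes y: "y \<in> Obj D" and i: "iso C (CS.\<kappa> (Omap G y))"
  shows "iso D (DS.\<kappa> y)"
proof (rule right_adjoint_reflects_iso[OF DS.\<kappa>_hom[OF y]])
  note d = functor_obj[OF DS.V y]
  note Gk = functor_hom[OF G DS.\<kappa>_hom[OF y]]
  note VGk = functor_hom[OF CS.V Gk]
  have "iso C (CS.\<kappa> (Omap G y) \<cdot>\<^bsub>C\<^esub> Amap CS.S (Amap V (Amap G (DS.\<kappa> y))))"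
    by (rule C.iso_comp[OF functor_iso[OF CS.S_functor iso_V_G_\<kappa>[OF y]] i
          CS.S_hom[OF VGk] CS.\<kappa>_hom[OF functor_obj[OF G y]]])
  then have "iso C (Amap G (DS.\<kappa> y) \<cdot>\<^bsub>C\<^esub> CS.\<kappa> (Omap G (I (Omap W y))))"
    using CS.\<kappa>_nat[OF Gk] by simp
  then show "iso C (Amap G (DS.\<kappa> y))"
    using C.iso_two_of_three[OF iso_\<kappa>_G_I[OF d] _ CS.\<kappa>_hom[OF G_I_obj[OF d]] Gk] by simp
qed

text \<open>
  Conversely to \<open>alg_hom_restrict\<close>: the equation precomposed with \<open>G (F (\<kappa> x))\<close> has as source a
  value of \<open>G\<close> on \<open>D\<^sub>0\<close>, where \<open>V\<close> is faithful, so it can be recovered from its image; then the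
  invertible \<open>G (F (\<kappa> x))\<close> cancels.
\<close>

lemma alg_hom_if_restrict:
  assumes x: "x \<in> Obj C" and y: "y \<in> Obj C" and i: "iso C (CS.\<kappa> x)"
    and a: "\<alpha> \<in> hom C (Omap G (Omap F x)) x" and b: "\<beta> \<in> hom C (Omap G (Omap F y)) y"
    and h: "h \<in> hom C x y"
    and r: "R.alg_hom (Omap V x) (restrict x \<alpha>) (Omap V y) (restrict y \<beta>) (Amap V h)"
  shows "alg_hom x \<alpha> y \<beta> h"
proof -
  let ?Tk = "Amap G (Amap F (CS.\<kappa> x))"
  note c = functor_obj[OF F\<^sub>0 functor_obj[OF CS.V x]]
  note Tk = T\<kappa>_hom[OF x] and Th = functor_hom[OF G functor_hom[OF F h]]
  note l = C.comp_hom[OF a h] and r' = C.comp_hom[OF Th b]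
  have "Amap V ((h \<cdot>\<^bsub>C\<^esub> \<alpha>) \<cdot>\<^bsub>C\<^esub> ?Tk) = Amap V ((\<beta> \<cdot>\<^bsub>C\<^esub> Amap G (Amap F h)) \<cdot>\<^bsub>C\<^esub> ?Tk)"
    using r restrict_left[OF x y a b h] restrict_right[OF x y a b h] by (simp add: R.alg_hom_def)
  then have "(h \<cdot>\<^bsub>C\<^esub> \<alpha>) \<cdot>\<^bsub>C\<^esub> ?Tk = (\<beta> \<cdot>\<^bsub>C\<^esub> Amap G (Amap F h)) \<cdot>\<^bsub>C\<^esub> ?Tk"
    using CS.faithful_on_coreflective[OF iso_\<kappa>_G_I[OF c] C.comp_hom[OF Tk l] C.comp_hom[OF Tk r']] by simp
  then have "h \<cdot>\<^bsub>C\<^esub> \<alpha> = \<beta> \<cdot>\<^bsub>C\<^esub> Amap G (Amap F h)"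
    using C.iso_cancel_right[OF functor_iso[OF G functor_iso[OF F i]] Tk l r'] by simp
  then show ?thesis using h by (simp add: alg_hom_def)
qed

text \<open>
  Algebra morphisms of the restricted monad lift to algebra morphisms of the big one, which come from
  \<open>D\<close>. An algebra \<open>(c, \<alpha>)\<close> of the restricted monad lifts to an algebra \<open>(J c, \<beta>)\<close>, which comes from
  some \<open>y\<close> in \<open>D\<close>; absorption puts \<open>G y\<close> into \<open>C\<^sub>0\<close>, so \<open>\<kappa> y\<close> is invertible and \<open>(c, \<alpha>)\<close> comes from
  \<open>W y\<close>.
\<close>

theorem restricted_monadic: "monadic_adjunction C\<^sub>0 D\<^sub>0 F\<^sub>0 G\<^sub>0 \<eta>\<^sub>0 \<epsilon>\<^sub>0"
  unfolding R.monadic_iff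
proof (intro conjI ballI allI impI ex_ex1I)
  fix d d' h
  assume d: "d \<in> Obj D\<^sub>0" and d': "d' \<in> Obj D\<^sub>0"
    and h: "R.alg_hom (Omap G\<^sub>0 d) (Amap G\<^sub>0 (\<epsilon>\<^sub>0 d)) (Omap G\<^sub>0 d') (Amap G\<^sub>0 (\<epsilon>\<^sub>0 d')) h"
  note o = DS.section_obj[OF d] DS.section_obj[OF d'] and x = G_I_obj[OF d] G_I_obj[OF d']
  have "h \<in> hom C\<^sub>0 (Omap V (Omap G (I d))) (Omap V (Omap G (I d')))"
    using h by (simp add: R.alg_hom_def G\<^sub>0_Omap)
  then obtain k where k: "k \<in> hom C (Omap G (I d)) (Omap G (I d'))" "Amap V k = h"
    using CS.full_on_coreflective[OF iso_\<kappa>_G_I[OF d] x] by blast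
  have "alg_hom (Omap G (I d)) (Amap G (\<epsilon> (I d))) (Omap G (I d')) (Amap G (\<epsilon> (I d'))) k"
    by (rule alg_hom_if_restrict[OF x iso_\<kappa>_G_I[OF d] functor_hom[OF G counit_hom[OF o(1)]]
          functor_hom[OF G counit_hom[OF o(2)]] k(1)])
      (use h k(2) in \<open>simp add: G\<^sub>0_counit d d' G\<^sub>0_Omap\<close>)
  then obtain m where m: "m \<in> hom D (I d) (I d')" "Amap G m = k" using ex1_alg_hom_lift[OF o] by blast
  have "Amap W m \<in> hom D\<^sub>0 d d'" "Amap G\<^sub>0 (Amap W m) = h"
    using functor_hom[OF DS.V m(1)] DS.section_over[OF d] DS.section_over[OF d'] DS.S_eq[OF d d' m(1)] m(2) k(2)
    by (simp_all add: G\<^sub>0_Amap)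
  then show "\<exists>m. m \<in> hom D\<^sub>0 d d' \<and> Amap G\<^sub>0 m = h" by blast
next
  fix d d' h m n
  assume d: "d \<in> Obj D\<^sub>0" and "m \<in> hom D\<^sub>0 d d' \<and> Amap G\<^sub>0 m = h" "n \<in> hom D\<^sub>0 d d' \<and> Amap G\<^sub>0 n = h"
  then have m: "m \<in> hom D\<^sub>0 d d'" and n: "n \<in> hom D\<^sub>0 d d'"
    and eq: "Amap V (Amap G (Amap DS.S m)) = Amap V (Amap G (Amap DS.S n))" by (auto simp: G\<^sub>0_Amap)
  note Sm = DS.S_hom[OF m] and Sn = DS.S_hom[OF n]
  have "Amap G (Amap DS.S m) = Amap G (Amap DS.S n)"
    using CS.faithful_on_coreflective[OF iso_\<kappa>_G_I[OF d] functor_hom[OF G Sm] functor_hom[OF G Sn] eq] .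
  then have "Amap DS.S m = Amap DS.S n" using right_adjoint_faithful[OF Sm Sn] by simp
  then show "m = n" using DS.S_over[OF m] DS.S_over[OF n] by metis
next
  fix c \<alpha> assume alg0: "R.alg c \<alpha>"
  then have c: "c \<in> Obj C\<^sub>0" and a: "\<alpha> \<in> hom C\<^sub>0 (Omap G\<^sub>0 (Omap F\<^sub>0 c)) c"
    and a1: "\<alpha> \<cdot>\<^bsub>C\<^sub>0\<^esub> \<eta>\<^sub>0 c = Id C\<^sub>0 c"
    and a2: "\<alpha> \<cdot>\<^bsub>C\<^sub>0\<^esub> Amap G\<^sub>0 (\<epsilon>\<^sub>0 (Omap F\<^sub>0 c)) = \<alpha> \<cdot>\<^bsub>C\<^sub>0\<^esub> Amap G\<^sub>0 (Amap F\<^sub>0 \<alpha>)"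
    by (auto simp: R.alg_def)
  let ?d = "Omap F\<^sub>0 c"
  note d = functor_obj[OF F\<^sub>0 c] and Jc = CS.section_obj[OF c]
  note x = G_I_obj[OF d] and Id = DS.section_obj[OF d]
  have FJ: "Omap F (J c) = I ?d" using sections[OF c] .
  have "\<alpha> \<in> hom C\<^sub>0 (Omap V (Omap G (I ?d))) (Omap V (J c))"
    using a CS.section_over[OF c] by (simp add: G\<^sub>0_Omap)
  then obtain \<beta> where b': "\<beta> \<in> hom C (Omap G (I ?d)) (J c)" and Vb: "Amap V \<beta> = \<alpha>"
    using CS.full_on_coreflective[OF iso_\<kappa>_G_I[OF d] x Jc] by blast
  have b: "\<beta> \<in> hom C (Omap G (Omap F (J c))) (J c)" using b' FJ by simp
  have "\<beta> \<cdot>\<^bsub>C\<^esub> \<eta> (J c) = Id C (J c)"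
    using functor_comp[OF CS.V unit_hom[OF Jc] b] Vb a1 functor_id[OF CS.V Jc] CS.section_over[OF c]
    by (intro CS.eq_if_same_image[OF c C.comp_hom[OF unit_hom[OF Jc] b] C.id_hom[OF Jc]]) (simp add: \<eta>\<^sub>0_def)
  \<comment> \<open>associativity of an action \<open>\<beta>\<close> says that \<open>\<beta>\<close> is an algebra morphism from the free algebra\<close>
  moreover have "alg_hom (Omap G (I ?d)) (Amap G (\<epsilon> (I ?d))) (J c) \<beta> \<beta>"
    using a a2 CS.section_over[OF c]
    by (intro alg_hom_if_restrict[OF x Jc iso_\<kappa>_G_I[OF d] functor_hom[OF G counit_hom[OF Id]] b b'])
      (simp add: Vb restrict_section[OF c b] G\<^sub>0_counit[OF d, symmetric] R.alg_hom_def G\<^sub>0_Omap)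
  ultimately have alg: "alg (J c) \<beta>" using Jc b FJ by (simp add: alg_def alg_hom_def)
  then obtain y f where y: "y \<in> Obj D" and f: "alg_hom (Omap G y) (Amap G (\<epsilon> y)) (J c) \<beta> f" and fi: "iso C f"
    by (rule ex_alg_iso)
  note Gy = functor_obj[OF G y]
  have fh: "f \<in> hom C (Omap G y) (J c)" using f by (simp add: alg_hom_def)
  \<comment> \<open>absorption applies because \<open>F f\<close> maps \<open>F (G y)\<close> to \<open>F (J c) = I (F\<^sub>0 c)\<close>\<close>
  have "iso C (CS.\<kappa> (Omap G y))"
    using coreflective_if_over_section[OF Gy d] functor_hom[OF F fh] FJ by simp
  then have k: "iso D (DS.\<kappa> y)" using iso_\<kappa>_if_iso_\<kappa>_G[OF y] by simp
  let ?e = "Omap W y"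
  note kh = DS.\<kappa>_hom[OF y] and e = functor_obj[OF DS.V y]
  note Ie = DS.section_obj[OF e]
  let ?g = "f \<cdot>\<^bsub>C\<^esub> Amap G (DS.\<kappa> y)"
  have "alg_hom (Omap G (I ?e)) (Amap G (\<epsilon> (I ?e))) (J c) \<beta> ?g"
    by (rule alg_hom_comp[OF alg_free[OF Ie] alg_free[OF y] alg alg_hom_free[OF kh] f])
  from alg_hom_restrict[OF G_I_obj[OF e] Jc functor_hom[OF G counit_hom[OF Ie]] b this]
  have "R.alg_hom (Omap G\<^sub>0 ?e) (Amap G\<^sub>0 (\<epsilon>\<^sub>0 ?e)) c \<alpha> (Amap V ?g)"
    by (simp add: G\<^sub>0_counit[OF e] restrict_section[OF c b] Vb CS.section_over[OF c] G\<^sub>0_Omap)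
  moreover have "iso C\<^sub>0 (Amap V ?g)"
    by (rule functor_iso[OF CS.V C.iso_comp[OF functor_iso[OF G k] fi functor_hom[OF G kh] fh]])
  ultimately show "\<exists>y \<in> Obj D\<^sub>0. \<exists>f. R.alg_hom (Omap G\<^sub>0 y) (Amap G\<^sub>0 (\<epsilon>\<^sub>0 y)) c \<alpha> f \<and> iso C\<^sub>0 f"
    using e by blast
qed

end

section \<open>Slice categories and pullbacks\<close>

lemma slice_Obj: "P \<in> Obj (slice C b) \<longleftrightarrow> P \<in> hom C (Dom C P) b"
  by (simp add: slice_def hom_def)

lemma slice_hom: "m \<in> hom (slice C b) P Q \<longleftrightarrow> P \<in> hom C (Dom C P) b \<and> Q \<in> hom C (Dom C Q) b \<and>
    (\<exists>h. m = (P, h, Q) \<and> h \<in> hom C (Dom C P) (Dom C Q) \<and> Q \<cdot>\<^bsub>C\<^esub> h = P)"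
  by (auto simp: slice_def hom_def)

lemma slice_Id: "Id (slice C b) P = (P, Id C (Dom C P), P)"
  and slice_Comp: "(Q', k, R) \<cdot>\<^bsub>slice C b\<^esub> (P, h, Q) = (P, k \<cdot>\<^bsub>C\<^esub> h, R)"
  by (simp_all add: slice_def)

lemma (in category) slice_category: "category (slice C b)"
proof (unfold_locales, goal_cases)
  case (1 f) then show ?case by (auto simp: slice_def)
next
  case (2 f) then show ?case by (auto simp: slice_def)
next
  case (3 P) then show ?case
    by (auto simp: slice_Obj slice_hom slice_Id comp_id_right intro: id_hom hom_obj1)
next
  case (4 f P Q g R) then show ?case
    using comp_assoc comp_hom by (fastforce simp: slice_hom slice_Comp)
next
  case (5 f P Q g R h S) then show ?case
    using comp_assoc by (fastforce simp: slice_hom slice_Comp)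
next
  case (6 f P Q) then show ?case
    by (auto simp: slice_hom slice_Comp slice_Id comp_id_left)
next
  case (7 f P Q) then show ?case
    by (auto simp: slice_hom slice_Comp slice_Id comp_id_right)
qed

lemma (in category) slice_iso:
  assumes m: "(P, h, Q) \<in> hom (slice C b) P Q" and i: "iso C h"
  shows "iso (slice C b) (P, h, Q)"
proof -
  have P: "P \<in> hom C (Dom C P) b" and Q: "Q \<in> hom C (Dom C Q) b"
    and h: "h \<in> hom C (Dom C P) (Dom C Q)" and Qh: "Q \<cdot> h = P"
    using m by (auto simp: slice_hom)
  obtain k where k: "k \<in> hom C (Dom C Q) (Dom C P)" "k \<cdot> h = Id C (Dom C P)" "h \<cdot> k = Id C (Dom C Q)"
    using isoE[OF i h] .
  have "P \<cdot> k = Q" using comp_assoc[OF k(1) h Q] Qh k(3) comp_id_right[OF Q] by simp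
  then have "(Q, k, P) \<in> hom (slice C b) Q P" using P Q k by (simp add: slice_hom)
  then show ?thesis
    by (rule category.isoI[OF slice_category m]) (simp_all add: slice_Comp slice_Id k)
qed

definition slice_func :: "('o, 'm, 'p, 'n) func \<Rightarrow> ('m, 'm \<times> 'm \<times> 'm, 'n, 'n \<times> 'n \<times> 'n) func" where
  "slice_func V = \<lparr>Omap = Amap V, Amap = (\<lambda>(P, h, Q). (Amap V P, Amap V h, Amap V Q))\<rparr>"

lemma slice_func_Omap [simp]: "Omap (slice_func V) P = Amap V P"
  and slice_func_Amap [simp]: "Amap (slice_func V) (P, h, Q) = (Amap V P, Amap V h, Amap V Q)"
  by (simp_all add: slice_func_def)

lemma slice_func_functor:
  assumes V: "is_functor E B V"
  shows "is_functor (slice E e) (slice B (Omap V e)) (slice_func V)"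
proof -
  have d: "Dom B (Amap V P) = Omap V (Dom E P)" if "P \<in> hom E (Dom E P) e" for P
    using functor_hom[OF V that] by (simp add: hom_dom)
  show ?thesis
  proof (rule is_functorI[OF category.slice_category[OF functor_dom[OF V]]
        category.slice_category[OF functor_cod[OF V]]], goal_cases)
    case (1 a) then show ?case
      using functor_hom[OF V] d by (auto simp: slice_Obj)
  next
    case (2 a b f)
    then obtain h where a: "a \<in> hom E (Dom E a) e" and b: "b \<in> hom E (Dom E b) e" and f: "f = (a, h, b)"
      and h: "h \<in> hom E (Dom E a) (Dom E b)" "b \<cdot>\<^bsub>E\<^esub> h = a" by (auto simp: slice_hom)
    have "Amap V b \<cdot>\<^bsub>B\<^esub> Amap V h = Amap V a" using functor_comp[OF V h(1) b] h(2) by simp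
    then show ?case
      using functor_hom[OF V a] functor_hom[OF V b] functor_hom[OF V h(1)]
      by (simp add: slice_hom f d[OF a] d[OF b])
  next
    case (3 a) then show ?case
      using functor_id[OF V category.hom_obj1[OF functor_dom[OF V]]] d
      by (simp add: slice_Obj slice_Id)
  next
    case (4 a b c f g) then show ?case
      using functor_comp[OF V] by (auto simp: slice_hom slice_Comp)
  qed
qed

lemma (in category) slice_postcomp_functor:
  assumes f: "f \<in> hom C a b"
  shows "is_functor (slice C a) (slice C b) (slice_postcomp C f)"
proof -
  have fP: "f \<cdot> P \<in> hom C (Dom C P) b" "Dom C (f \<cdot> P) = Dom C P" if "P \<in> hom C (Dom C P) a" for P
    using comp_hom[OF that f] by (simp_all add: hom_dom)
  show ?thesis
  proof (rule is_functorI[OF slice_category slice_category], goal_cases)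
    case (1 P) then show ?case using fP[of P] by (simp add: slice_Obj slice_postcomp_def)
  next
    case (2 P Q m) then show ?case
      using fP[of P] fP[of Q] comp_assoc[OF _ _ f] by (auto simp: slice_hom slice_postcomp_def)
  next
    case (3 P) then show ?case using fP[of P] by (simp add: slice_Obj slice_postcomp_def slice_Id)
  next
    case (4 P Q R m n) then show ?case by (auto simp: slice_hom slice_postcomp_def slice_Comp)
  qed
qed

text \<open>
  The pullback of \<open>g\<close> has projections \<open>G g\<close> and the counit at \<open>g\<close>: an arrow \<open>f \<cdot> u \<rightarrow> g\<close> in the
  slice is a commutative square over \<open>f\<close> and \<open>g\<close>, and its transpose is the induced arrow.
\<close>

lemma has_pullbacks_if_adjunction:
  assumes B: "category B" and f: "f \<in> hom B a b"
    and adj: "adjunction (slice B a) (slice B b) (slice_postcomp B f) G \<eta> \<epsilon>"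
  shows "has_pullbacks_along B f"
  unfolding has_pullbacks_along_def
proof (intro ballI impI)
  interpret B: category B by (rule B)
  interpret L: adjoint_pair "slice B a" "slice B b" "slice_postcomp B f" G \<eta> \<epsilon>
    by unfold_locales (rule adj)
  fix g assume "g \<in> Arr B" "Cod B g = Cod B f"
  then have g: "g \<in> hom B (Dom B g) b" using f by (simp add: hom_def)
  then have go: "g \<in> Obj (slice B b)" by (simp add: slice_Obj)
  define q where "q = Omap G g"
  have q: "q \<in> hom B (Dom B q) a"
    using functor_obj[OF L.G go] by (simp add: q_def slice_Obj)
  have fq: "f \<cdot>\<^bsub>B\<^esub> q \<in> hom B (Dom B q) b" using B.comp_hom[OF q f] .
  obtain r where e: "\<epsilon> g = (f \<cdot>\<^bsub>B\<^esub> q, r, g)" and r: "r \<in> hom B (Dom B q) (Dom B g)" "g \<cdot>\<^bsub>B\<^esub> r = f \<cdot>\<^bsub>B\<^esub> q"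
    using L.counit_hom[OF go] hom_dom[OF fq] by (auto simp: slice_hom slice_postcomp_def q_def)
  have "is_pullback B f g q r" unfolding is_pullback_def
  proof (intro conjI allI impI)
    fix s u v
    assume "u \<in> hom B s (Dom B f) \<and> v \<in> hom B s (Dom B g) \<and> f \<cdot>\<^bsub>B\<^esub> u = g \<cdot>\<^bsub>B\<^esub> v"
    then have u: "u \<in> hom B s a" and v: "v \<in> hom B s (Dom B g)" and eq: "f \<cdot>\<^bsub>B\<^esub> u = g \<cdot>\<^bsub>B\<^esub> v"
      using f by (auto simp: hom_def)
    have fu: "f \<cdot>\<^bsub>B\<^esub> u \<in> hom B s b" using B.comp_hom[OF u f] .
    have "(f \<cdot>\<^bsub>B\<^esub> u, v, g) \<in> hom (slice B b) (Omap (slice_postcomp B f) u) g"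
      using fu g v by (simp add: slice_hom slice_postcomp_def hom_dom[OF fu] eq[symmetric])
    moreover have "u \<in> Obj (slice B a)" using u by (simp add: slice_Obj hom_dom[OF u])
    ultimately have "\<exists>!h. h \<in> hom (slice B a) u q \<and>
        \<epsilon> g \<cdot>\<^bsub>slice B b\<^esub> Amap (slice_postcomp B f) h = (f \<cdot>\<^bsub>B\<^esub> u, v, g)"
      using L.ex1_transpose[OF _ go] by (simp add: q_def)
    moreover have "(u, h, q) \<in> hom (slice B a) u q \<and>
        \<epsilon> g \<cdot>\<^bsub>slice B b\<^esub> Amap (slice_postcomp B f) (u, h, q) = (f \<cdot>\<^bsub>B\<^esub> u, v, g)
        \<longleftrightarrow> h \<in> hom B s (Dom B q) \<and> q \<cdot>\<^bsub>B\<^esub> h = u \<and> r \<cdot>\<^bsub>B\<^esub> h = v" for h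
      using u q by (auto simp: slice_hom hom_dom[OF u] e slice_postcomp_def slice_Comp)
    moreover have "m \<in> hom (slice B a) u q \<Longrightarrow> \<exists>h. m = (u, h, q)" for m by (auto simp: slice_hom)
    ultimately show "\<exists>!h. h \<in> hom B s (Dom B q) \<and> q \<cdot>\<^bsub>B\<^esub> h = u \<and> r \<cdot>\<^bsub>B\<^esub> h = v"
      by (metis prod.inject)
  qed (use f g q r in \<open>simp_all add: hom_def\<close>)
  then show "\<exists>q r. is_pullback B f g q r" by blast
qed

section \<open>Descent along a functor with a left adjoint section\<close>

context left_adjoint_section
begin

definition slice_section :: "'o \<Rightarrow> 'n \<Rightarrow> 'm" where
  "slice_section e g = lift (Dom B g) e g"

lemma
  assumes e: "e \<in> Obj E" and g: "g \<in> hom B (Dom B g) (Omap V e)"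
  shows slice_section_hom: "slice_section e g \<in> hom E (J (Dom B g)) e"
    and slice_section_over: "Amap V (slice_section e g) = g"
  using lift_hom[OF e g] lift_over[OF e g] by (simp_all add: slice_section_def)

lemma slice_section_eq:
  assumes e: "e \<in> Obj E" and m: "m \<in> hom E (J c) e" and c: "c \<in> Obj B"
  shows "slice_section e (Amap V m) = m"
proof -
  have Vm: "Amap V m \<in> hom B c (Omap V e)" using functor_hom[OF V m] section_over[OF c] by simp
  then have Vm': "Amap V m \<in> hom B (Dom B (Amap V m)) (Omap V e)" by (simp add: hom_dom[OF Vm])
  show ?thesis
    using eq_if_same_image[OF c _ m slice_section_over[OF e Vm']] slice_section_hom[OF e Vm'] hom_dom[OF Vm] by simp
qed

text \<open>
  The lift of an arrow \<open>m : g \<rightarrow> V P\<close> of slices is the lift of \<open>m\<close> itself; it is an arrow over \<open>e\<close>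
  because \<open>P\<close> after the lift and the lift of \<open>g\<close> have the same image.
\<close>

lemma slice_left_adjoint_section:
  assumes e: "e \<in> Obj E"
  shows "left_adjoint_section (slice E e) (slice B (Omap V e)) (slice_func V) (slice_section e)"
proof (unfold_locales, goal_cases)
  case 1 show ?case by (rule slice_func_functor[OF V])
next
  case (2 g) then show ?case
    using slice_section_hom[OF e, of g] by (auto simp: slice_Obj hom_def)
next
  case (3 g) then show ?case
    using slice_section_over[OF e, of g] by (simp add: slice_Obj)
next
  case (4 g P f)
  have g: "g \<in> hom B (Dom B g) (Omap V e)" and P: "P \<in> hom E (Dom E P) e"
    using 4 by (simp_all add: slice_Obj)
  note VP = functor_hom[OF V P] and L = slice_section_hom[OF e g]
  note c = B.hom_obj1[OF g]
  obtain m where f: "f = (g, m, Amap V P)" and m: "m \<in> hom B (Dom B g) (Omap V (Dom E P))"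
      "Amap V P \<cdot>\<^bsub>B\<^esub> m = g"
    using 4(3) hom_dom[OF VP] by (auto simp: slice_hom)
  have P_comp: "P \<cdot>\<^bsub>E\<^esub> k = slice_section e g"
    if k: "k \<in> hom E (J (Dom B g)) (Dom E P)" "Amap V k = m" for k
    using functor_comp[OF V k(1) P] k(2) m(2) slice_section_over[OF e g]
    by (intro eq_if_same_image[OF c E.comp_hom[OF k(1) P] L]) simp
  have "k \<in> hom (slice E e) (slice_section e g) P \<and> Amap (slice_func V) k = f \<longleftrightarrow>
      (\<exists>h. k = (slice_section e g, h, P) \<and> h \<in> hom E (J (Dom B g)) (Dom E P) \<and> Amap V h = m)" for k
    using L P P_comp slice_section_over[OF e g] by (auto simp: slice_hom hom_dom[OF L] f)
  moreover have "\<exists>!h. h \<in> hom E (J (Dom B g)) (Dom E P) \<and> Amap V h = m"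
    using ex1_lift[OF c E.hom_obj1[OF P] m(1)] .
  ultimately show ?case by metis
qed

text \<open>
  For \<open>p : a \<rightarrow> b\<close> the result on restricted monadic adjunctions is applied to postcomposition with
  \<open>p\<close> and with \<open>V p\<close>. Absorption passes to slices since an arrow from \<open>p \<cdot> P\<close> to the section of
  \<open>g\<close> is in particular an arrow \<open>Dom P \<rightarrow> J (Dom g)\<close>.
\<close>

theorem preserves_effective_descent:
  assumes coreflective_if_over_section:
    "\<And>e c f. \<lbrakk>c \<in> Obj B; f \<in> hom E e (J c)\<rbrakk> \<Longrightarrow> iso E (\<kappa> e)"
  shows "preserves_effective_descent E B V"
  unfolding preserves_effective_descent_def
proof (intro allI impI)
  fix p assume p: "effective_descent E p"
  define a b f where "a = Dom E p" and "b = Cod E p" and "f = Amap V p"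
  have ph: "p \<in> hom E a b" using p by (simp add: effective_descent_def hom_def a_def b_def)
  obtain G \<eta> \<epsilon> where mon: "monadic_adjunction (slice E a) (slice E b) (slice_postcomp E p) G \<eta> \<epsilon>"
    using p by (auto simp: effective_descent_def a_def b_def)
  note a = E.hom_obj1[OF ph] and b = E.hom_obj2[OF ph]
  have f: "f \<in> hom B (Omap V a) (Omap V b)" using functor_hom[OF V ph] by (simp add: f_def)
  interpret SA: left_adjoint_section "slice E a" "slice B (Omap V a)" "slice_func V" "slice_section a"
    by (rule slice_left_adjoint_section[OF a])
  interpret SB: left_adjoint_section "slice E b" "slice B (Omap V b)" "slice_func V" "slice_section b"
    by (rule slice_left_adjoint_section[OF b])
  \<comment> \<open>the counit of the slice is carried by the counit of \<open>E\<close>, so it is invertible when the latter is\<close>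
  have SA_\<kappa>: "SA.\<kappa> P = (slice_section a (Amap V P), \<kappa> (Dom E P), P)" if P: "P \<in> hom E (Dom E P) a" for P
  proof (rule SA.eq_if_same_image)
    have Po: "P \<in> Obj (slice E a)" using P by (simp add: slice_Obj)
    note VP = functor_hom[OF V P] and k = \<kappa>_hom[OF E.hom_obj1[OF P]]
    have dVP: "Dom B (Amap V P) = Omap V (Dom E P)" using hom_dom[OF VP] .
    show "Amap V P \<in> Obj (slice B (Omap V a))" using VP by (simp add: slice_Obj dVP)
    show "SA.\<kappa> P \<in> hom (slice E a) (slice_section a (Amap V P)) P"
      using SA.\<kappa>_hom[OF Po] by simp
    have Pk: "P \<cdot>\<^bsub>E\<^esub> \<kappa> (Dom E P) = slice_section a (Amap V P)"
      using slice_section_eq[OF a E.comp_hom[OF k P] B.hom_obj1[OF VP]] functor_comp[OF V k P]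
        \<kappa>_over[OF E.hom_obj1[OF P]] B.comp_id_right[OF VP] by simp
    have L: "slice_section a (Amap V P) \<in> hom E (J (Omap V (Dom E P))) a"
      using E.comp_hom[OF k P] Pk by simp
    show "(slice_section a (Amap V P), \<kappa> (Dom E P), P) \<in> hom (slice E a) (slice_section a (Amap V P)) P"
      using L P k Pk by (simp add: slice_hom hom_dom[OF L])
    show "Amap (slice_func V) (SA.\<kappa> P) = Amap (slice_func V) (slice_section a (Amap V P), \<kappa> (Dom E P), P)"
      using SA.\<kappa>_over[OF Po] slice_section_over[OF a, of "Amap V P"] \<kappa>_over[OF E.hom_obj1[OF P]] VP
      by (simp add: slice_Id dVP)
  qed
  interpret coreflected_monadic_adjunction "slice E a" "slice E b" "slice_postcomp E p" G \<eta> \<epsilon>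
    "slice B (Omap V a)" "slice_func V" "slice_section a"
    "slice B (Omap V b)" "slice_func V" "slice_section b" "slice_postcomp B f"
  proof (unfold_locales, goal_cases)
    case 1 show ?case using mon by (simp add: monadic_adjunction_def)
  next
    case 2 show ?case by (rule B.slice_postcomp_functor[OF f])
  next
    case (3 P) then show ?case
      using functor_comp[OF V _ ph] by (auto simp: slice_Obj slice_postcomp_def f_def)
  next
    case (4 m) 
    then obtain P Q where "m \<in> hom (slice E a) P Q" by (auto simp: hom_def)
    then show ?case
      using functor_comp[OF V _ ph] by (auto simp: slice_hom slice_postcomp_def f_def)
  next
    case (5 g)
    then have g: "g \<in> hom B (Dom B g) (Omap V a)" by (simp add: slice_Obj)
    note L = slice_section_hom[OF a g]
    show ?case
      using slice_section_eq[OF b E.comp_hom[OF L ph] B.hom_obj1[OF g]] functor_comp[OF V L ph]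
        slice_section_over[OF a g] by (simp add: slice_postcomp_def f_def)
  next
    case 6 show ?case by (rule mon)
  next
    case (7 P g m)
    have P: "P \<in> hom E (Dom E P) a" and g: "g \<in> hom B (Dom B g) (Omap V b)"
      using 7 by (simp_all add: slice_Obj)
    obtain h where "h \<in> hom E (Dom E P) (J (Dom B g))"
      using 7(3) by (auto simp: slice_hom slice_postcomp_def hom_dom[OF slice_section_hom[OF b g]]
          hom_dom[OF E.comp_hom[OF P ph]])
    then have "iso E (\<kappa> (Dom E P))" using coreflective_if_over_section[OF B.hom_obj1[OF g]] by blast
    moreover have "(slice_section a (Amap V P), \<kappa> (Dom E P), P) \<in> hom (slice E a) (slice_section a (Amap V P)) P"
      using SA.\<kappa>_hom[OF 7(1)] by (simp add: SA_\<kappa>[OF P])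
    ultimately show ?case using E.slice_iso by (simp add: SA_\<kappa>[OF P])
  qed
  show "effective_descent B (Amap V p)"
    using restricted_monadic has_pullbacks_if_adjunction[OF B.category_axioms f restricted_adjunction]
      hom_arr[OF f] hom_dom[OF f] hom_cod[OF f]
    unfolding effective_descent_def f_def by auto
qed

end

section \<open>The op-Grothendieck construction\<close>

context pseudofunctor
begin

lemma opgroth_Obj: "(a, x) \<in> Obj (opgroth A H) \<longleftrightarrow> a \<in> Obj A \<and> x \<in> Obj (Fib H a)"
  by (simp add: opgroth_def)

lemma opgroth_hom: "m \<in> hom (opgroth A H) (a, x) (b, y) \<longleftrightarrow>
    x \<in> Obj (Fib H a) \<and> y \<in> Obj (Fib H b) \<and>
    (\<exists>f \<phi>. m = ((a, x), (f, \<phi>), (b, y)) \<and> f \<in> hom A a b \<and> \<phi> \<in> hom (Fib H b) (Omap (Push H f) x) y)"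
  by (auto simp: opgroth_def hom_def)

lemma opgroth_Id: "Id (opgroth A H) (a, x) = ((a, x), (Id A a, Iota H a x), (a, x))"
  and opgroth_Comp: "(Y', (g, \<psi>), (c, z)) \<cdot>\<^bsub>opgroth A H\<^esub> ((a, x), (f, \<phi>), Y) =
    ((a, x), (g \<cdot> f, (\<psi> \<cdot>\<^bsub>Fib H c\<^esub> Amap (Push H g) \<phi>) \<cdot>\<^bsub>Fib H c\<^esub> Delta H g f x), (c, z))"
  by (cases Y; cases Y'; simp add: opgroth_def)+

lemma
  assumes f: "f \<in> hom A a b" and g: "g \<in> hom A b c"
  shows delta_hom: "x \<in> Obj (Fib H a) \<Longrightarrow> Delta H g f x \<in> hom (Fib H c)
      (Omap (Push H (g \<cdot> f)) x) (Omap (Push H g) (Omap (Push H f) x))"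
    and delta_nat: "\<phi> \<in> hom (Fib H a) x y \<Longrightarrow> Delta H g f y \<cdot>\<^bsub>Fib H c\<^esub> Amap (Push H (g \<cdot> f)) \<phi>
      = Amap (Push H g) (Amap (Push H f) \<phi>) \<cdot>\<^bsub>Fib H c\<^esub> Delta H g f x"
  using nat_trans_hom[OF nat_iso_nat_trans[OF delta_iso[OF f g]]]
    nat_trans_nat[OF nat_iso_nat_trans[OF delta_iso[OF f g]]] by (simp_all add: comp_func_def)

lemma
  assumes a: "a \<in> Obj A"
  shows iota_hom: "x \<in> Obj (Fib H a) \<Longrightarrow> Iota H a x \<in> hom (Fib H a) (Omap (Push H (Id A a)) x) x"
    and iota_nat: "\<phi> \<in> hom (Fib H a) x y \<Longrightarrow> Iota H a y \<cdot>\<^bsub>Fib H a\<^esub> Amap (Push H (Id A a)) \<phi>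
      = \<phi> \<cdot>\<^bsub>Fib H a\<^esub> Iota H a x"
  using nat_trans_hom[OF nat_iso_nat_trans[OF iota_iso[OF a]]]
    nat_trans_nat[OF nat_iso_nat_trans[OF iota_iso[OF a]]] by (simp_all add: id_func_def)

lemma opgroth_comp_fiber_hom:
  assumes f: "f \<in> hom A a b" and g: "g \<in> hom A b c" and x: "x \<in> Obj (Fib H a)"
    and \<phi>: "\<phi> \<in> hom (Fib H b) (Omap (Push H f) x) y" and \<psi>: "\<psi> \<in> hom (Fib H c) (Omap (Push H g) y) z"
  shows "(\<psi> \<cdot>\<^bsub>Fib H c\<^esub> Amap (Push H g) \<phi>) \<cdot>\<^bsub>Fib H c\<^esub> Delta H g f x \<in> hom (Fib H c) (Omap (Push H (g \<cdot> f)) x) z"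
proof -
  interpret Fc: category "Fib H c" by (rule fib_category[OF hom_obj2[OF g]])
  show ?thesis
    using Fc.comp_hom[OF delta_hom[OF f g x] Fc.comp_hom[OF functor_hom[OF push_functor[OF g] \<phi>] \<psi>]] .
qed

text \<open>
  The fiber components of the two bracketings of a triple composite; naturality of \<open>Delta H h g\<close>
  moves it past \<open>\<phi>\<close>, where the coherence axiom \<open>delta_assoc\<close> applies.
\<close>

lemma opgroth_fiber_assoc:
  assumes f: "f \<in> hom A a b" and g: "g \<in> hom A b c" and h: "h \<in> hom A c d" and x: "x \<in> Obj (Fib H a)"
    and \<phi>: "\<phi> \<in> hom (Fib H b) (Omap (Push H f) x) y"
    and \<psi>: "\<psi> \<in> hom (Fib H c) (Omap (Push H g) y) z"
    and \<chi>: "\<chi> \<in> hom (Fib H d) (Omap (Push H h) z) w"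
  shows "(((\<chi> \<cdot>\<^bsub>Fib H d\<^esub> Amap (Push H h) \<psi>) \<cdot>\<^bsub>Fib H d\<^esub> Delta H h g y)
        \<cdot>\<^bsub>Fib H d\<^esub> Amap (Push H (h \<cdot> g)) \<phi>) \<cdot>\<^bsub>Fib H d\<^esub> Delta H (h \<cdot> g) f x
    = (\<chi> \<cdot>\<^bsub>Fib H d\<^esub> Amap (Push H h) ((\<psi> \<cdot>\<^bsub>Fib H c\<^esub> Amap (Push H g) \<phi>) \<cdot>\<^bsub>Fib H c\<^esub> Delta H g f x))
        \<cdot>\<^bsub>Fib H d\<^esub> Delta H h (g \<cdot> f) x"
proof -
  interpret Fb: category "Fib H b" by (rule fib_category[OF hom_obj2[OF f]])
  interpret Fc: category "Fib H c" by (rule fib_category[OF hom_obj2[OF g]])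
  interpret Fd: category "Fib H d" by (rule fib_category[OF hom_obj2[OF h]])
  note gf = comp_hom[OF f g] and hg = comp_hom[OF g h]
  note y = Fb.hom_obj2[OF \<phi>] and fx = functor_obj[OF push_functor[OF f] x]
  note h' = push_functor[OF h]
  note g\<phi> = functor_hom[OF push_functor[OF g] \<phi>]
  note \<psi>g\<phi> = Fc.comp_hom[OF g\<phi> \<psi>] and \<delta> = delta_hom[OF f g x]
  note h\<psi> = functor_hom[OF h' \<psi>] and hg\<phi> = functor_hom[OF h' g\<phi>] and h\<delta> = functor_hom[OF h' \<delta>]
  note \<chi>h\<psi> = Fd.comp_hom[OF h\<psi> \<chi>]
  note \<delta>y = delta_hom[OF g h y] and \<delta>fx = delta_hom[OF g h fx]
    and \<delta>l = delta_hom[OF f hg x] and \<delta>r = delta_hom[OF gf h x]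
  \<comment> \<open>the source in the bracketing of the other composite\<close>
  have \<delta>l: "Delta H (h \<cdot> g) f x \<in> hom (Fib H d) (Omap (Push H (h \<cdot> (g \<cdot> f))) x) (Omap (Push H (h \<cdot> g)) (Omap (Push H f) x))"
    using \<delta>l comp_assoc[OF f g h] by simp
  note p\<phi> = functor_hom[OF push_functor[OF hg] \<phi>]
  let ?c = "\<chi> \<cdot>\<^bsub>Fib H d\<^esub> Amap (Push H h) \<psi>" and ?hg\<phi> = "Amap (Push H h) (Amap (Push H g) \<phi>)"
  have "((?c \<cdot>\<^bsub>Fib H d\<^esub> Delta H h g y) \<cdot>\<^bsub>Fib H d\<^esub> Amap (Push H (h \<cdot> g)) \<phi>) \<cdot>\<^bsub>Fib H d\<^esub> Delta H (h \<cdot> g) f x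
      = (?c \<cdot>\<^bsub>Fib H d\<^esub> (?hg\<phi> \<cdot>\<^bsub>Fib H d\<^esub> Delta H h g (Omap (Push H f) x))) \<cdot>\<^bsub>Fib H d\<^esub> Delta H (h \<cdot> g) f x"
    using Fd.comp_assoc[OF p\<phi> \<delta>y \<chi>h\<psi>] delta_nat[OF g h \<phi>] by simp
  also have "\<dots> = (?c \<cdot>\<^bsub>Fib H d\<^esub> ?hg\<phi>)
      \<cdot>\<^bsub>Fib H d\<^esub> (Delta H h g (Omap (Push H f) x) \<cdot>\<^bsub>Fib H d\<^esub> Delta H (h \<cdot> g) f x)"
    using Fd.comp_assoc[OF \<delta>fx hg\<phi> \<chi>h\<psi>] Fd.comp_assoc[OF \<delta>l \<delta>fx Fd.comp_hom[OF hg\<phi> \<chi>h\<psi>]] by simp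
  also have "\<dots> = (?c \<cdot>\<^bsub>Fib H d\<^esub> ?hg\<phi>)
      \<cdot>\<^bsub>Fib H d\<^esub> (Amap (Push H h) (Delta H g f x) \<cdot>\<^bsub>Fib H d\<^esub> Delta H h (g \<cdot> f) x)"
    using delta_assoc[OF f g h x] by simp
  also have "\<dots> = ((\<chi> \<cdot>\<^bsub>Fib H d\<^esub> (Amap (Push H h) \<psi> \<cdot>\<^bsub>Fib H d\<^esub> ?hg\<phi>)) \<cdot>\<^bsub>Fib H d\<^esub> Amap (Push H h) (Delta H g f x))
      \<cdot>\<^bsub>Fib H d\<^esub> Delta H h (g \<cdot> f) x"
    using Fd.comp_assoc[OF \<delta>r h\<delta> Fd.comp_hom[OF hg\<phi> \<chi>h\<psi>]] Fd.comp_assoc[OF hg\<phi> h\<psi> \<chi>] by simp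
  also have "\<dots> = (\<chi> \<cdot>\<^bsub>Fib H d\<^esub> Amap (Push H h) ((\<psi> \<cdot>\<^bsub>Fib H c\<^esub> Amap (Push H g) \<phi>) \<cdot>\<^bsub>Fib H c\<^esub> Delta H g f x))
      \<cdot>\<^bsub>Fib H d\<^esub> Delta H h (g \<cdot> f) x"
    using Fd.comp_assoc[OF h\<delta> Fd.comp_hom[OF hg\<phi> h\<psi>] \<chi>] functor_comp[OF h' g\<phi> \<psi>]
      functor_comp[OF h' \<delta> \<psi>g\<phi>] by simp
  finally show ?thesis .
qed

lemma opgroth_category: "category (opgroth A H)"
proof (unfold_locales, goal_cases)
  case (1 f) then show ?case by (auto simp: opgroth_def hom_def dom_obj)
next
  case (2 f) then show ?case by (auto simp: opgroth_def hom_def cod_obj)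
next
  case (3 X) then show ?case
    by (cases X) (auto simp: opgroth_Obj opgroth_hom opgroth_Id id_hom iota_hom)
next
  case (4 m X Y n Z) then show ?case
    by (cases X; cases Y; cases Z) (auto simp: opgroth_hom opgroth_Comp comp_hom opgroth_comp_fiber_hom)
next
  case (5 m X Y n Z k W)
  obtain a x b y c z d w where X: "X = (a, x)" "Y = (b, y)" "Z = (c, z)" "W = (d, w)"
    by (cases X; cases Y; cases Z; cases W)
  obtain f \<phi> g \<psi> h \<chi> where m: "m = (X, (f, \<phi>), Y)" "n = (Y, (g, \<psi>), Z)" "k = (Z, (h, \<chi>), W)"
    and f: "f \<in> hom A a b" and g: "g \<in> hom A b c" and h: "h \<in> hom A c d" and x: "x \<in> Obj (Fib H a)"
    and \<phi>: "\<phi> \<in> hom (Fib H b) (Omap (Push H f) x) y"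
    and \<psi>: "\<psi> \<in> hom (Fib H c) (Omap (Push H g) y) z"
    and \<chi>: "\<chi> \<in> hom (Fib H d) (Omap (Push H h) z) w"
    using 5 by (auto simp: X opgroth_hom)
  show ?case
    using comp_assoc[OF f g h] opgroth_fiber_assoc[OF f g h x \<phi> \<psi> \<chi>] by (simp add: m X opgroth_Comp)
next
  case (6 m X Y)
  obtain a x b y where X: "X = (a, x)" "Y = (b, y)" by (cases X; cases Y)
  obtain f \<phi> where m: "m = (X, (f, \<phi>), Y)" and f: "f \<in> hom A a b" and x: "x \<in> Obj (Fib H a)"
    and \<phi>: "\<phi> \<in> hom (Fib H b) (Omap (Push H f) x) y"
    using 6 by (auto simp: X opgroth_hom)
  note b = hom_obj2[OF f]
  interpret Fb: category "Fib H b" by (rule fib_category[OF b])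
  note fx = functor_obj[OF push_functor[OF f] x]
  have "(Iota H b y \<cdot>\<^bsub>Fib H b\<^esub> Amap (Push H (Id A b)) \<phi>) \<cdot>\<^bsub>Fib H b\<^esub> Delta H (Id A b) f x = \<phi>"
    using iota_nat[OF b \<phi>] delta_iota_left[OF f x] Fb.comp_id_right[OF \<phi>]
      Fb.comp_assoc[OF delta_hom[OF f id_hom[OF b] x] iota_hom[OF b fx] \<phi>] by simp
  then show ?case by (simp add: m X opgroth_Id opgroth_Comp comp_id_left[OF f])
next
  case (7 m X Y)
  obtain a x b y where X: "X = (a, x)" "Y = (b, y)" by (cases X; cases Y)
  obtain f \<phi> where m: "m = (X, (f, \<phi>), Y)" and f: "f \<in> hom A a b" and x: "x \<in> Obj (Fib H a)"
    and \<phi>: "\<phi> \<in> hom (Fib H b) (Omap (Push H f) x) y"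
    using 7 by (auto simp: X opgroth_hom)
  note a = hom_obj1[OF f]
  interpret Fb: category "Fib H b" by (rule fib_category[OF hom_obj2[OF f]])
  note f\<iota> = functor_hom[OF push_functor[OF f] iota_hom[OF a x]]
  have "(\<phi> \<cdot>\<^bsub>Fib H b\<^esub> Amap (Push H f) (Iota H a x)) \<cdot>\<^bsub>Fib H b\<^esub> Delta H f (Id A a) x = \<phi>"
    using delta_iota_right[OF f x] Fb.comp_id_right[OF \<phi>]
      Fb.comp_assoc[OF delta_hom[OF id_hom[OF a] f x] f\<iota> \<phi>] by simp
  then show ?case by (simp add: m X opgroth_Id opgroth_Comp comp_id_right[OF f])
qed

lemma opgroth_proj_functor: "is_functor (opgroth A H) A opgroth_proj"
  by (rule is_functorI[OF opgroth_category category_axioms])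
    (auto simp: opgroth_proj_def opgroth_Obj opgroth_hom opgroth_Id opgroth_Comp)

end

theorem theorem19:
  fixes A :: "('a, 'f) cat" and H :: "('a, 'f, 'x, 'm) psfunctor"
  assumes "category A"
    and "pseudofunctor A H"
    and "\<And>a. a \<in> Obj A \<Longrightarrow> \<exists>z. strict_initial (Fib H a) z"
    and "\<And>a b f. f \<in> hom A a b \<Longrightarrow> creates_initial_objects (Fib H a) (Fib H b) (Push H f)"
  shows "preserves_effective_descent (opgroth A H) A opgroth_proj"
proof -
  interpret pseudofunctor A H by (rule assms(2))
  let ?E = "opgroth A H" and ?V = "opgroth_proj :: ('a \<times> 'x, ('a \<times> 'x) \<times> ('f \<times> 'm) \<times> ('a \<times> 'x), 'a, 'f) func"
  interpret E: category ?E by (rule opgroth_category)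
  obtain z where z: "\<And>a. a \<in> Obj A \<Longrightarrow> strict_initial (Fib H a) (z a)" using assms(3) by metis
  have z_init: "initial (Fib H a) (z a)" if "a \<in> Obj A" for a
    using z[OF that] by (simp add: strict_initial_def)
  have push_initial: "initial (Fib H b) (Omap (Push H f) x) \<longleftrightarrow> initial (Fib H a) x"
    if "f \<in> hom A a b" "x \<in> Obj (Fib H a)" for a b f x
    using assms(4)[OF that(1)] that(2) by (simp add: creates_initial_objects_def)
  \<comment> \<open>stated for all initial objects of a fiber, not only the chosen ones, so that it also yields
    the inverse of the counit at \<open>(d, w)\<close> below\<close>
  have ex1_from_initial: "\<exists>!m. m \<in> hom ?E (a, x) Y \<and> Amap ?V m = f"
    if x: "initial (Fib H a) x" and Y: "Y \<in> Obj ?E" and f: "f \<in> hom A a (Omap ?V Y)" for a x Y f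
  proof -
    obtain b y where Yb: "Y = (b, y)" by (cases Y)
    have fb: "f \<in> hom A a b" using f by (simp add: Yb opgroth_proj_def)
    have y: "y \<in> Obj (Fib H b)" using Y by (simp add: Yb opgroth_Obj)
    have xo: "x \<in> Obj (Fib H a)" using x by (simp add: initial_def)
    have "\<exists>!\<phi>. \<phi> \<in> hom (Fib H b) (Omap (Push H f) x) y"
      using push_initial[OF fb xo] x y by (simp add: initial_def)
    moreover have "m \<in> hom ?E (a, x) Y \<and> Amap ?V m = f \<longleftrightarrow>
        (\<exists>\<phi>. m = ((a, x), (f, \<phi>), Y) \<and> \<phi> \<in> hom (Fib H b) (Omap (Push H f) x) y)" for m
      using fb xo y by (auto simp: Yb opgroth_hom opgroth_proj_def)
    ultimately show ?thesis by metis
  qed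
  interpret S: left_adjoint_section ?E A ?V "\<lambda>a. (a, z a)"
  proof (unfold_locales, goal_cases)
    case 1 show ?case by (rule opgroth_proj_functor)
  next
    case (2 c) then show ?case using z_init[OF 2] by (simp add: opgroth_Obj initial_def)
  next
    case (3 c) show ?case by (simp add: opgroth_proj_def)
  next
    case (4 c e f) then show ?case using ex1_from_initial[OF z_init] by simp
  qed
  show ?thesis
  proof (rule S.preserves_effective_descent)
    fix X c m assume c: "c \<in> Obj A" and m: "m \<in> hom ?E X (c, z c)"
    obtain d w where X: "X = (d, w)" by (cases X)
    obtain r \<phi> where r: "r \<in> hom A d c" and w: "w \<in> Obj (Fib H d)"
      and \<phi>: "\<phi> \<in> hom (Fib H c) (Omap (Push H r) w) (z c)"
      using m by (auto simp: X opgroth_hom)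
    \<comment> \<open>strictness in the fiber over \<open>c\<close>, then reflection of initial objects along \<open>r\<close>\<close>
    have "isomorphic (Fib H c) (Omap (Push H r) w) (z c)"
      using z[OF c] functor_obj[OF push_functor[OF r] w] \<phi> by (auto simp: strict_initial_def)
    then have "initial (Fib H c) (Omap (Push H r) w)"
      by (rule initial_isomorphic[OF fib_category[OF c] z_init[OF c]])
    then have w_init: "initial (Fib H d) w" using push_initial[OF r w] by simp
    note Xo = E.hom_obj1[OF m]
    have d: "d \<in> Obj A" using hom_obj1[OF r] .
    have VX: "Omap ?V X = d" by (simp add: X opgroth_proj_def)
    note k = S.\<kappa>_hom[OF Xo, unfolded VX] and Vk = S.\<kappa>_over[OF Xo, unfolded VX]
    have Vz: "Omap ?V (d, z d) = d" by (simp add: opgroth_proj_def)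
    obtain j where j: "j \<in> hom ?E X (d, z d)" "Amap ?V j = Id A d"
      using ex1_from_initial[OF w_init S.section_obj[OF d], unfolded Vz, OF id_hom[OF d]] unfolding X by blast
    have "j \<cdot>\<^bsub>?E\<^esub> S.\<kappa> X = Id ?E (d, z d)"
      using functor_comp[OF S.V k j(1)] Vk j(2) comp_id_left[OF id_hom[OF d]] functor_id[OF S.V S.section_obj[OF d]] Vz
      by (intro S.eq_if_same_image[OF d E.comp_hom[OF k j(1)] E.id_hom[OF S.section_obj[OF d]]]) simp
    moreover have "S.\<kappa> X \<cdot>\<^bsub>?E\<^esub> j = Id ?E X"
    proof -
      have "Amap ?V (S.\<kappa> X \<cdot>\<^bsub>?E\<^esub> j) = Id A d" "Amap ?V (Id ?E X) = Id A d"
        using functor_comp[OF S.V j(1) k] Vk j(2) comp_id_left[OF id_hom[OF d]] functor_id[OF S.V Xo] VX by simp_all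
      then show ?thesis
        using ex1_from_initial[OF w_init Xo, of "Id A d"] id_hom[OF d] E.comp_hom[OF j(1) k] E.id_hom[OF Xo] VX
        unfolding X by auto
    qed
    ultimately show "iso ?E (S.\<kappa> X)" using E.isoI[OF k j(1)] by simp
  qed
qed

end
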